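(* Let $F:\mathbb{R}^d\to\mathbb{R}$ be differentiable, $\mu$-strongly convex and $L$-smooth with $L\ge\mu>0$, let $\kappa=L/\mu$, and suppose the stochastic gradients satisfy the noise model with constants $c,\sigma^2\ge 0$ described in the context. Choose $\beta\ge 2\kappa^2$ and communication times $\mathcal{I}=\{\tau_i \mid i=1,\ldots,R\}$ with $0=\tau_0<\tau_1<\cdots<\tau_R=T$ such that, with $H_i:=\tau_{i+1}-\tau_i$, $$9\kappa^2 c\,\ln\Big(1+\frac{H_i-1}{\tau_i+\beta}\Big)+2\kappa\Big(1+\frac{c}{n}\Big)-(\tau_i+1+\beta)\le 0,\qquad i=0,\ldots,R-1.$$ Set $\eta_k=\frac{2}{\mu(k+\beta)}$ for $k=0,\ldots,T-1$. Then the iterates of Local SGD with $n$ workers, step sizes $\eta_k$ and communication times $\mathcal{I}$ satisfy $$\mathbb{E}[F(\bar{\mathbf{x}}^T)]-F^*\le \frac{\beta^2\,(F(\bar{\mathbf{x}}^0)-F^* )}{T^2}+\frac{2L\sigma^2}{n\mu^2T}+\frac{9L^2\sigma^2}{\mu^3T^2}\sum_{t=0}^{T-1}\frac{t-\tau(t)}{t+\beta},$$ where $F^*:=\min_{\mathbf{x}}F(\mathbf{x})$ and $\tau(t):=\max\{t'\in\{\tau_0,\tau_1,\ldots,\tau_R\}\mid t'\le t\}$ is the most recent communication time.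
   Context: Norms are Euclidean. $F$ is differentiable, $\mu$-strongly convex and $L$-smooth in the sense that for all $\mathbf{x},\mathbf{y}\in\mathbb{R}^d$, $$\frac{\mu}{2}\|\mathbf{x}-\mathbf{y}\|^2\le F(\mathbf{y})-F(\mathbf{x})-\langle\nabla F(\mathbf{x}),\mathbf{y}-\mathbf{x}\rangle\le\frac{L}{2}\|\mathbf{x}-\mathbf{y}\|^2 .$$ Local SGD: there are $n\ge1$ workers and $T\ge 1$ iterations, a set $\mathcal{I}\subseteq\{1,\ldots,T\}$ of communication times and step sizes $\eta_0,\ldots,\eta_{T-1}$. All workers start at a common deterministic point $\mathbf{x}_i^0=\mathbf{x}^0\in\mathbb{R}^d$, and for $t=0,\ldots,T-1$, $$\mathbf{x}_i^{t+1}=\begin{cases}\mathbf{x}_i^t-\eta_t\hat{\mathbf{g}}_i^t,& t+1\notin\mathcal{I},\\ \frac1n\sum_{j=1}^n(\mathbf{x}_j^t-\eta_t\hat{\mathbf{g}}_j^t),& t+1\in\mathcal{I},\end{cases}$$ where $\hat{\mathbf{g}}_i^t$ is worker $i$'s stochastic gradient at $\mathbf{x}_i^t$. The average iterate is $\bar{\mathbf{x}}^t:=\frac1n\sum_{i=1}^n\mathbf{x}_i^t$. Noise model (constants $c,\sigma^2\ge0$): $\hat{\mathbf{g}}_i^t=\nabla F(\mathbf{x}_i^t)+\boldsymbol{\epsilon}_i^t$. Let $\mathcal{F}^t$ be the information (sigma-algebra) generated by $\{\mathbf{x}_i^k,\hat{\mathbf{g}}_i^k: 1\le i\le n,\ 0\le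 k\le t-1\}\cup\{\mathbf{x}_i^t:1\le i\le n\}$. Conditionally on $\mathcal{F}^t$, the noises $\boldsymbol{\epsilon}_1^t,\ldots,\boldsymbol{\epsilon}_n^t$ are independent, $\mathbb{E}[\boldsymbol{\epsilon}_i^t\mid\mathcal{F}^t]=\mathbf{0}$, and $\mathbb{E}[\|\boldsymbol{\epsilon}_i^t\|^2\mid\mathcal{F}^t]\le c\|\nabla F(\mathbf{x}_i^t)\|^2+\sigma^2$. *)

theory Defs
  imports "HOL-Probability.Probability"
begin

definition strongly_convex_smooth ::
    "real \<Rightarrow> real \<Rightarrow> ('a::euclidean_space \<Rightarrow> real) \<Rightarrow> ('a \<Rightarrow> 'a) \<Rightarrow> bool" where
  "strongly_convex_smooth \<mu> L F gradF \<longleftrightarrow>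
     (\<forall>x. GDERIV F x :> gradF x) \<and>
     (\<forall>x y. \<mu> / 2 * (norm (x - y))\<^sup>2 \<le> F y - F x - gradF x \<bullet> (y - x) \<and>
            F y - F x - gradF x \<bullet> (y - x) \<le> L / 2 * (norm (x - y))\<^sup>2)"

text \<open>The least element of the range is the minimum whenever the minimum is attained.\<close>

definition min_value :: "('a \<Rightarrow> real) \<Rightarrow> real" where
  "min_value F = (LEAST v. v \<in> range F)"

definition worker_avg :: "nat \<Rightarrow> (nat \<Rightarrow> 'a::real_vector) \<Rightarrow> 'a" where
  "worker_avg n y = (1 / real n) *\<^sub>R (\<Sum>i = 1..n. y i)"

text \<open>Local SGD along one sample path, with iterates \<open>x i t\<close> and stochastic gradients \<open>g i t\<close>
  of worker \<open>i\<close> at time \<open>t\<close>.\<close>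

definition local_sgd ::
    "nat \<Rightarrow> nat \<Rightarrow> nat set \<Rightarrow> (nat \<Rightarrow> real) \<Rightarrow> 'a::real_vector \<Rightarrow>
     (nat \<Rightarrow> nat \<Rightarrow> 'a) \<Rightarrow> (nat \<Rightarrow> nat \<Rightarrow> 'a) \<Rightarrow> bool" where
  "local_sgd n T I \<eta> x0 x g \<longleftrightarrow>
     (\<forall>i\<in>{1..n}. x i 0 = x0) \<and>
     (\<forall>t<T. \<forall>i\<in>{1..n}.
        x i (Suc t) =
          (if Suc t \<in> I then worker_avg n (\<lambda>j. x j t - \<eta> t *\<^sub>R g j t)
           else x i t - \<eta> t *\<^sub>R g i t))"

definition last_comm :: "(nat \<Rightarrow> nat) \<Rightarrow> nat \<Rightarrow> nat \<Rightarrow> nat" where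
  "last_comm \<tau> R t = Max {s \<in> \<tau> ` {0..R}. s \<le> t}"

text \<open>The sigma-algebra generated by all iterates up to time \<open>t\<close> and all stochastic gradients
  strictly before time \<open>t\<close>.\<close>

definition history ::
    "'w measure \<Rightarrow> nat \<Rightarrow> (nat \<Rightarrow> nat \<Rightarrow> 'w \<Rightarrow> 'a::topological_space) \<Rightarrow>
     (nat \<Rightarrow> nat \<Rightarrow> 'w \<Rightarrow> 'a) \<Rightarrow> nat \<Rightarrow> 'w measure" where
  "history M n x g t = sigma (space M)
     ({x i k -` B \<inter> space M | i k B. i \<in> {1..n} \<and> k \<le> t \<and> B \<in> sets borel} \<union>
      {g i k -` B \<inter> space M | i k B. i \<in> {1..n} \<and> k < t \<and> B \<in> sets borel})"

text \<open>Conditional expectation of a vector-valued variable, taken coordinatewise.\<close>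

definition vec_cond_exp ::
    "'w measure \<Rightarrow> 'w measure \<Rightarrow> ('w \<Rightarrow> 'a::euclidean_space) \<Rightarrow> 'w \<Rightarrow> 'a" where
  "vec_cond_exp M G X =
     (\<lambda>\<omega>. \<Sum>b\<in>Basis. real_cond_exp M G (\<lambda>\<omega>'. X \<omega>' \<bullet> b) \<omega> *\<^sub>R b)"

text \<open>The conditional counterpart of \<open>prob_space.indep_vars\<close>: the joint conditional probabilities
  given \<open>G\<close> factorize almost surely.\<close>

definition cond_indep_vars ::
    "'w measure \<Rightarrow> 'w measure \<Rightarrow> ('i \<Rightarrow> 'b measure) \<Rightarrow> ('i \<Rightarrow> 'w \<Rightarrow> 'b) \<Rightarrow> 'i set \<Rightarrow> bool" where
  "cond_indep_vars M G N X I \<longleftrightarrow>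
     (\<forall>i\<in>I. X i \<in> measurable M (N i)) \<and>
     (\<forall>J A. J \<subseteq> I \<longrightarrow> J \<noteq> {} \<longrightarrow> finite J \<longrightarrow> (\<forall>i\<in>J. A i \<in> sets (N i)) \<longrightarrow>
        (AE \<omega> in M.
           real_cond_exp M G (indicator (\<Inter>i\<in>J. X i -` A i \<inter> space M)) \<omega> =
           (\<Prod>i\<in>J. real_cond_exp M G (indicator (X i -` A i \<inter> space M)) \<omega>)))"

text \<open>The second moment uses the \<open>ennreal\<close>-valued conditional expectation, which is meaningful
  without integrability; the bound then makes the vector-valued one meaningful as well.\<close>

definition noise_model ::
    "'w measure \<Rightarrow> nat \<Rightarrow> nat \<Rightarrow> real \<Rightarrow> real \<Rightarrow> ('a::euclidean_space \<Rightarrow> 'a) \<Rightarrow>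
     (nat \<Rightarrow> nat \<Rightarrow> 'w \<Rightarrow> 'a) \<Rightarrow> (nat \<Rightarrow> nat \<Rightarrow> 'w \<Rightarrow> 'a) \<Rightarrow> bool" where
  "noise_model M n T c \<sigma> gradF x g \<longleftrightarrow>
     (\<forall>t<T.
        let G = history M n x g t;
            \<epsilon> = (\<lambda>i \<omega>. g i t \<omega> - gradF (x i t \<omega>))
        in cond_indep_vars M G (\<lambda>_. borel) \<epsilon> {1..n} \<and>
           (\<forall>i\<in>{1..n}.
              (AE \<omega> in M. vec_cond_exp M G (\<epsilon> i) \<omega> = 0) \<and>
              (AE \<omega> in M. nn_cond_exp M G (\<lambda>\<omega>'. ennreal ((norm (\<epsilon> i \<omega>'))\<^sup>2)) \<omega>
                 \<le> ennreal (c * (norm (gradF (x i t \<omega>)))\<^sup>2 + \<sigma>\<^sup>2))))"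

end

theory Submission
  imports Defs
begin

text \<open>
  Let \<open>\<xi>\<^sub>t\<close> be the expected gap \<open>F - F\<^sup>*\<close> at the average iterate, \<open>V\<^sub>t\<close> the expected mean squared
  distance of the workers from their average, \<open>G\<^sub>t\<close> the mean over the workers of the second moment of
  the gradient at their own iterate, \<open>Q\<^sub>t\<close> the second moment of the gradient at the average iterate,
  and \<open>s = t + \<beta>\<close>, so that the step size is \<open>\<eta> = 2 / (\<mu> s)\<close>.

  Communicating or not, the average iterate moves by the average stochastic gradient. Smoothness of
  \<open>F\<close>, unbiasedness and the orthogonality of the noises of different workers give
  \<open>\<xi>\<^sub>t\<^sub>+\<^sub>1 \<le> \<xi>\<^sub>t - \<eta>/2 (Q\<^sub>t + G\<^sub>t) + \<eta> L\<^sup>2/2 V\<^sub>t + L \<eta>\<^sup>2/2 ((1 + c/n) G\<^sub>t + \<sigma>\<^sup>2/n)\<close>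
  (\<open>expected_descent\<close>), where \<open>Q\<^sub>t \<ge> 2 \<mu> \<xi>\<^sub>t\<close> by strong convexity. A gradient step with
  \<open>\<eta> L\<^sup>2 \<le> \<mu>\<close>, which is what \<open>\<beta> \<ge> 2 \<kappa>\<^sup>2\<close> ensures, contracts the dispersion of the workers, so that
  \<open>V\<^sub>t\<^sub>+\<^sub>1 \<le> (1 - \<eta> \<mu>) V\<^sub>t + \<eta>\<^sup>2 (1 - 1/n) (c G\<^sub>t + \<sigma>\<^sup>2)\<close> between communications
  (\<open>expected_dispersion_after_step\<close>). As \<open>s\<^sup>2 (1 - 2/s) \<le> (s - 1)\<^sup>2\<close>, both recursions telescope after
  multiplication by \<open>s\<^sup>2\<close>.

  The rest concerns real sequences. In a round \<open>{a..<b}\<close> between two communications, unrolling the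
  second recursion from \<open>V\<^sub>a = 0\<close> bounds \<open>s V\<^sub>t\<close> by \<open>4 s / (\<mu> (s - 1))\<^sup>2\<close> times the noise accumulated
  since \<open>a\<close>. Its \<open>\<sigma>\<^sup>2\<close> part is the last term of the claim. Its \<open>c G\<close> part has to be paid for by the
  negative multiple of \<open>G\<close> in the first recursion; since the sum of \<open>4 s / (s - 1)\<^sup>2\<close> over \<open>{a<..<b}\<close>
  is at most \<open>9 ln (1 + (b - a - 1) / (a + \<beta>))\<close>, the condition on the communication times pays for every
  step of the round except the first, where it falls short by one unit: it has \<open>a + 1 + \<beta>\<close> where
  \<open>a + \<beta>\<close> would be needed.

  That unit is recovered as follows. At the start of a round all workers agree, so \<open>G = Q\<close>, and the
  bound \<open>Q \<ge> 2 \<mu> \<xi>\<close> may be applied after everything else has been subtracted. In the very first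
  round this is enough, because the initial gap may be weighted by \<open>\<beta>\<^sup>2\<close> instead of \<open>(\<beta> - 1)\<^sup>2\<close>. In a
  later round it gains only \<open>1/2\<close>; the other half comes from the constant \<open>9\<close>, which is not sharp
  there: the sum of \<open>4 s / (s - 1)\<^sup>2\<close> is at most three quarters of the logarithmic bound
  (\<open>sum_drift_le_ln\<close>), and the factor \<open>1 - 1/n\<close> helps when there are few workers
  (\<open>step_size_condition_absorbs_half\<close>). A later round of length one has no \<open>c G\<close> part to pay for, and the
  condition for the first round covers it.
\<close>

section \<open>Strongly convex smooth functions\<close>

context
  fixes \<mu> L :: real and F :: "'a::euclidean_space \<Rightarrow> real" and gradF :: "'a \<Rightarrow> 'a"
  assumes scs: "strongly_convex_smooth \<mu> L F gradF" and \<mu>_pos: "0 < \<mu>" and \<mu>_le_L: "\<mu> \<le> L"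
begin

lemma quadratic_lower_bound: "F x + gradF x \<bullet> (y - x) + \<mu> / 2 * (norm (y - x))\<^sup>2 \<le> F y"
  using scs unfolding strongly_convex_smooth_def by (smt (verit) norm_minus_commute)

lemma quadratic_upper_bound: "F y \<le> F x + gradF x \<bullet> (y - x) + L / 2 * (norm (y - x))\<^sup>2"
  using scs unfolding strongly_convex_smooth_def by (smt (verit) norm_minus_commute)

lemma continuous_on_objective: "continuous_on UNIV F"
proof -
  have "GDERIV F x :> gradF x" for x
    using scs by (simp add: strongly_convex_smooth_def)
  then show ?thesis
    unfolding gderiv_def by (meson has_derivative_continuous continuous_at_imp_continuous_on)
qed

lemma gradient_strongly_monotone: "\<mu> * (norm (x - y))\<^sup>2 \<le> (gradF x - gradF y) \<bullet> (x - y)"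
  using quadratic_lower_bound[of x y] quadratic_lower_bound[of y x]
  by (simp add: inner_diff_left inner_diff_right norm_minus_commute)

text \<open>Compare the lower bound at \<open>x\<close> and the upper bound at \<open>y\<close> in the point that a step of length
  \<open>1 / L\<close> along the gradient difference reaches from \<open>y\<close>.\<close>

lemma gradient_gap_le_Bregman:
  "(norm (gradF y - gradF x))\<^sup>2 / (2 * L) \<le> F y - F x - gradF x \<bullet> (y - x)"
proof -
  have L_pos: "0 < L"
    using \<mu>_pos \<mu>_le_L by simp
  define d where "d = gradF y - gradF x"
  define z where "z = y - (1 / L) *\<^sub>R d"
  have "0 \<le> \<mu> / 2 * (norm (z - x))\<^sup>2"
    using \<mu>_pos by simp
  then have lower: "F x + gradF x \<bullet> (z - x) \<le> F z"
    using quadratic_lower_bound[of x z] by linarith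
  have upper: "F z \<le> F y + gradF y \<bullet> (z - y) + L / 2 * (norm (z - y))\<^sup>2"
    by (rule quadratic_upper_bound)
  have zy: "L / 2 * (norm (z - y))\<^sup>2 = (norm d)\<^sup>2 / (2 * L)"
    using L_pos by (simp add: z_def power_mult_distrib power_divide power2_eq_square)
  have "gradF y \<bullet> (z - y) - gradF x \<bullet> (z - x) = - (gradF x \<bullet> (y - x)) - (d \<bullet> d) / L"
    by (simp add: z_def d_def inner_diff_left inner_diff_right diff_divide_distrib)
  with lower upper zy have "(d \<bullet> d) / L - (norm d)\<^sup>2 / (2 * L) \<le> F y - F x - gradF x \<bullet> (y - x)"
    by linarith
  moreover have "d \<bullet> d / L = 2 * ((norm d)\<^sup>2 / (2 * L))"
    unfolding power2_norm_eq_inner by (simp add: field_simps)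
  ultimately have "(norm d)\<^sup>2 / (2 * L) \<le> F y - F x - gradF x \<bullet> (y - x)"
    by linarith
  then show ?thesis
    by (simp only: d_def)
qed

text \<open>Adding the Bregman bound to the one with \<open>x\<close> and \<open>y\<close> exchanged gives cocoercivity of the
  gradient; Cauchy--Schwarz turns it into Lipschitz continuity.\<close>

lemma gradient_Lipschitz: "norm (gradF x - gradF y) \<le> L * norm (x - y)"
proof -
  have L_pos: "0 < L"
    using \<mu>_pos \<mu>_le_L by simp
  let ?d = "norm (gradF x - gradF y)"
  have "?d\<^sup>2 / (2 * L) + ?d\<^sup>2 / (2 * L) \<le> (gradF x - gradF y) \<bullet> (x - y)"
    using gradient_gap_le_Bregman[of x y] gradient_gap_le_Bregman[of y x]
    by (simp add: inner_diff_left inner_diff_right norm_minus_commute)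
  also have "\<dots> \<le> ?d * norm (x - y)"
    by (rule norm_cauchy_schwarz)
  finally have "?d * ?d \<le> ?d * (L * norm (x - y))"
    using L_pos by (simp add: field_simps power2_eq_square)
  then show ?thesis
    using L_pos by (cases "?d = 0") (auto simp: mult_le_cancel_left)
qed

lemma continuous_on_gradient: "continuous_on UNIV gradF"
proof (rule lipschitz_on_continuous_on)
  show "L-lipschitz_on UNIV gradF"
    using gradient_Lipschitz \<mu>_pos \<mu>_le_L by (auto simp: lipschitz_on_def dist_norm)
qed

lemma gradient_domination: "F x - F y \<le> (norm (gradF x))\<^sup>2 / (2 * \<mu>)"
proof -
  define v where "v = y - x"
  \<comment> \<open>completing the square in the quadratic lower bound, as a function of \<open>v\<close>\<close>
  have "0 \<le> (norm (gradF x + \<mu> *\<^sub>R v))\<^sup>2 / (2 * \<mu>)"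
    using \<mu>_pos by simp
  also have "\<dots> = (norm (gradF x))\<^sup>2 / (2 * \<mu>) + gradF x \<bullet> v + \<mu> / 2 * (norm v)\<^sup>2"
    using \<mu>_pos unfolding power2_norm_eq_inner
    by (simp add: inner_add_left inner_add_right inner_commute field_simps power2_eq_square)
  finally show ?thesis
    using quadratic_lower_bound[of x y] unfolding v_def by linarith
qed

text \<open>Outside a large ball around the origin the quadratic lower bound is at least \<open>F 0\<close>, so a minimum over
  the ball is a global one.\<close>

lemma minimum_attained: "\<exists>x. \<forall>y. F x \<le> F y"
proof -
  define r where "r = 2 * norm (gradF 0) / \<mu>"
  have "0 \<le> r"
    using \<mu>_pos by (simp add: r_def)
  then have "\<exists>x\<in>cball 0 r. \<forall>y\<in>cball 0 r. F x \<le> F y"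
    by (intro continuous_attains_inf continuous_on_subset[OF continuous_on_objective]) auto
  then obtain x where x: "x \<in> cball 0 r" "\<And>y. y \<in> cball 0 r \<Longrightarrow> F x \<le> F y"
    by blast
  have "F x \<le> F y" for y
  proof (cases "y \<in> cball 0 r")
    case False
    then have "norm (gradF 0) * norm y \<le> \<mu> / 2 * norm y * norm y"
      using \<mu>_pos by (intro mult_right_mono) (auto simp: r_def field_simps)
    moreover have "- (norm (gradF 0) * norm y) \<le> gradF 0 \<bullet> y"
      using Cauchy_Schwarz_ineq2[of "gradF 0" y] by linarith
    ultimately have "F 0 \<le> F y"
      using quadratic_lower_bound[of 0 y] by (simp add: power2_eq_square)
    moreover have "F x \<le> F 0"
      using \<mu>_pos by (intro x(2)) (auto simp: r_def)
    ultimately show ?thesis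
      by linarith
  qed (use x(2) in auto)
  then show ?thesis
    by blast
qed

lemma min_value_attained: obtains x where "min_value F = F x"
proof -
  obtain x where "\<forall>y. F x \<le> F y"
    using minimum_attained by blast
  then have "min_value F = F x"
    unfolding min_value_def by (intro Least_equality) auto
  then show thesis
    by (rule that)
qed

lemma min_value_le: "min_value F \<le> F x"
proof -
  obtain y where "\<forall>z. F y \<le> F z"
    using minimum_attained by blast
  then have "min_value F = F y"
    unfolding min_value_def by (intro Least_equality) auto
  with \<open>\<forall>z. F y \<le> F z\<close> show ?thesis
    by simp
qed

lemma Polyak_Lojasiewicz: "2 * \<mu> * (F x - min_value F) \<le> (norm (gradF x))\<^sup>2"
proof -
  obtain y where "min_value F = F y"
    by (rule min_value_attained)
  then show ?thesis
    using gradient_domination[of x y] \<mu>_pos by (simp add: field_simps)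
qed

end

section \<open>Averages and dispersion\<close>

text \<open>The population variance of a finite family of vectors.\<close>

definition dispersion :: "nat \<Rightarrow> (nat \<Rightarrow> 'a::real_inner) \<Rightarrow> real" where
  "dispersion n y = worker_avg n (\<lambda>i. (norm (y i - worker_avg n y))\<^sup>2)"

lemma worker_avg_cong:
  "(\<And>i. i \<in> {1..n} \<Longrightarrow> y i = z i) \<Longrightarrow> worker_avg n y = worker_avg n z"
  by (simp add: worker_avg_def)

lemma worker_avg_const: "1 \<le> n \<Longrightarrow> worker_avg n (\<lambda>_. a) = a"
  by (simp add: worker_avg_def scaleR_conv_of_real sum_constant_scaleR)

lemma worker_avg_add: "worker_avg n (\<lambda>i. y i + z i) = worker_avg n y + worker_avg n z"
  by (simp add: worker_avg_def sum.distrib scaleR_add_right)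

lemma worker_avg_diff: "worker_avg n (\<lambda>i. y i - z i) = worker_avg n y - worker_avg n z"
  by (simp add: worker_avg_def sum_subtractf scaleR_diff_right)

lemma worker_avg_scaleR: "worker_avg n (\<lambda>i. r *\<^sub>R y i) = r *\<^sub>R worker_avg n y"
  by (simp add: worker_avg_def scaleR_sum_right[symmetric] mult.commute)

lemma worker_avg_mult: "worker_avg n (\<lambda>i. r * y i :: real) = r * worker_avg n y"
  using worker_avg_scaleR[of n r y] by simp

lemma worker_avg_inner_right: "worker_avg n (\<lambda>i. a \<bullet> y i) = a \<bullet> worker_avg n y"
  by (simp add: worker_avg_def inner_sum_right)

lemma worker_avg_mono:
  fixes y z :: "nat \<Rightarrow> real"
  shows "(\<And>i. i \<in> {1..n} \<Longrightarrow> y i \<le> z i) \<Longrightarrow> worker_avg n y \<le> worker_avg n z"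
  unfolding worker_avg_def by (intro scaleR_left_mono sum_mono) auto

lemma worker_avg_nonneg:
  fixes y :: "nat \<Rightarrow> real"
  shows "(\<And>i. i \<in> {1..n} \<Longrightarrow> 0 \<le> y i) \<Longrightarrow> 0 \<le> worker_avg n y"
  unfolding worker_avg_def by (intro scaleR_nonneg_nonneg sum_nonneg) auto

lemma dispersion_about:
  assumes "1 \<le> n"
  shows "worker_avg n (\<lambda>i. (norm (y i - a))\<^sup>2) = dispersion n y + (norm (worker_avg n y - a))\<^sup>2"
proof -
  let ?m = "worker_avg n y"
  have "(norm (y i - a))\<^sup>2
      = (norm (y i - ?m))\<^sup>2 + 2 * ((?m - a) \<bullet> (y i - ?m)) + (norm (?m - a))\<^sup>2" for i
    by (simp add: power2_norm_eq_inner inner_diff_left inner_diff_right inner_commute)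
  then have "worker_avg n (\<lambda>i. (norm (y i - a))\<^sup>2)
      = dispersion n y + 2 * ((?m - a) \<bullet> worker_avg n (\<lambda>i. y i - ?m)) + (norm (?m - a))\<^sup>2"
    using assms
    by (simp add: worker_avg_add worker_avg_mult worker_avg_const worker_avg_inner_right dispersion_def)
  also have "worker_avg n (\<lambda>i. y i - ?m) = 0"
    using assms by (simp add: worker_avg_diff worker_avg_const)
  finally show ?thesis
    by simp
qed

lemma norm_worker_avg_le:
  fixes y :: "nat \<Rightarrow> 'a::real_inner"
  assumes "1 \<le> n"
  shows "(norm (worker_avg n y))\<^sup>2 \<le> worker_avg n (\<lambda>i. (norm (y i))\<^sup>2)"
  using dispersion_about[OF assms, of y 0] worker_avg_nonneg[of n "\<lambda>i. (norm (y i - worker_avg n y))\<^sup>2"]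
  by (simp add: dispersion_def)

lemma dispersion_const: "1 \<le> n \<Longrightarrow> (\<And>i. i \<in> {1..n} \<Longrightarrow> y i = a) \<Longrightarrow> dispersion n y = 0"
proof -
  assume n: "1 \<le> n" and y: "\<And>i. i \<in> {1..n} \<Longrightarrow> y i = a"
  have "worker_avg n y = a"
    using worker_avg_cong[of n y "\<lambda>_. a"] y worker_avg_const[OF n, of a] by simp
  then show ?thesis
    using y by (simp add: dispersion_def worker_avg_def)
qed

text \<open>The cross term involves \<open>e i\<close> itself rather than its deviation from the average, because the
  deviations of \<open>p\<close> sum to zero. It is therefore linear in the individual noises.\<close>

lemma dispersion_diff:
  assumes "1 \<le> n"
  shows "dispersion n (\<lambda>i. p i - r *\<^sub>R e i)
    = dispersion n p - 2 * r * worker_avg n (\<lambda>i. (p i - worker_avg n p) \<bullet> e i)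
      + r\<^sup>2 * dispersion n e"
proof -
  let ?p = "\<lambda>i. p i - worker_avg n p" and ?e = "\<lambda>i. e i - worker_avg n e"
  have "(norm (?p i - r *\<^sub>R ?e i))\<^sup>2
      = (norm (?p i))\<^sup>2 - 2 * r * (?p i \<bullet> e i - worker_avg n e \<bullet> ?p i) + r\<^sup>2 * (norm (?e i))\<^sup>2" for i
  proof -
    have "(norm (?p i - r *\<^sub>R ?e i))\<^sup>2
        = (norm (?p i))\<^sup>2 - 2 * r * (?p i \<bullet> ?e i) + r\<^sup>2 * (norm (?e i))\<^sup>2"
      unfolding power2_norm_eq_inner
      by (simp only: inner_diff_left inner_diff_right inner_scaleR_left inner_scaleR_right)
        (simp add: inner_commute algebra_simps power2_eq_square)
    then show ?thesis
      by (simp add: inner_diff_right inner_commute)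
  qed
  moreover have "dispersion n (\<lambda>i. p i - r *\<^sub>R e i) = worker_avg n (\<lambda>i. (norm (?p i - r *\<^sub>R ?e i))\<^sup>2)"
    by (simp add: dispersion_def worker_avg_diff worker_avg_scaleR algebra_simps)
  ultimately have "dispersion n (\<lambda>i. p i - r *\<^sub>R e i)
      = dispersion n p - 2 * r * (worker_avg n (\<lambda>i. ?p i \<bullet> e i) - worker_avg n e \<bullet> worker_avg n ?p)
        + r\<^sup>2 * dispersion n e"
    by (simp add: worker_avg_add worker_avg_diff worker_avg_mult worker_avg_inner_right dispersion_def)
  also have "worker_avg n ?p = 0"
    using assms by (simp add: worker_avg_diff worker_avg_const)
  finally show ?thesis
    by simp
qed

text \<open>The dispersion is at most the mean squared distance to any point. Taking the image of the average
  under the gradient step reduces the claim to the contraction of distances under that step.\<close>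

lemma gradient_step_contracts_dispersion:
  fixes y :: "nat \<Rightarrow> 'a::euclidean_space"
  assumes scs: "strongly_convex_smooth \<mu> L F gradF" and \<mu>: "0 < \<mu>" "\<mu> \<le> L" and n: "1 \<le> n"
    and r: "0 \<le> r" "r * L\<^sup>2 \<le> \<mu>"
  shows "dispersion n (\<lambda>i. y i - r *\<^sub>R gradF (y i)) \<le> (1 - r * \<mu>) * dispersion n y"
proof -
  let ?m = "worker_avg n y"
  let ?a = "?m - r *\<^sub>R gradF ?m"
  have *: "(norm (y i - r *\<^sub>R gradF (y i) - ?a))\<^sup>2 \<le> (1 - r * \<mu>) * (norm (y i - ?m))\<^sup>2" for i
  proof -
    let ?v = "y i - ?m" and ?d = "gradF (y i) - gradF ?m"
    have "y i - r *\<^sub>R gradF (y i) - ?a = ?v - r *\<^sub>R ?d"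
      by (simp add: algebra_simps)
    then have "(norm (y i - r *\<^sub>R gradF (y i) - ?a))\<^sup>2 = (norm ?v)\<^sup>2 - 2 * r * (?d \<bullet> ?v) + r\<^sup>2 * (norm ?d)\<^sup>2"
      unfolding power2_norm_eq_inner
      by (simp only: inner_diff_left inner_diff_right inner_scaleR_left inner_scaleR_right)
        (simp add: inner_commute algebra_simps power2_eq_square)
    also have "\<dots> \<le> (norm ?v)\<^sup>2 - 2 * r * (\<mu> * (norm ?v)\<^sup>2) + r\<^sup>2 * (L * norm ?v)\<^sup>2"
      using r(1) gradient_strongly_monotone[OF scs \<mu>, of "y i" ?m] gradient_Lipschitz[OF scs \<mu>, of "y i" ?m]
      by (intro add_mono diff_mono mult_left_mono power_mono) auto
    also have "\<dots> = (1 - r * \<mu>) * (norm ?v)\<^sup>2 - r * (\<mu> - r * L\<^sup>2) * (norm ?v)\<^sup>2"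
      by (simp add: algebra_simps power2_eq_square)
    also have "\<dots> \<le> (1 - r * \<mu>) * (norm ?v)\<^sup>2"
      using r by simp
    finally show ?thesis .
  qed
  have "dispersion n (\<lambda>i. y i - r *\<^sub>R gradF (y i)) \<le> worker_avg n (\<lambda>i. (norm (y i - r *\<^sub>R gradF (y i) - ?a))\<^sup>2)"
    using dispersion_about[OF n, of "\<lambda>i. y i - r *\<^sub>R gradF (y i)" ?a] by simp
  also have "\<dots> \<le> worker_avg n (\<lambda>i. (1 - r * \<mu>) * (norm (y i - ?m))\<^sup>2)"
    using * by (rule worker_avg_mono)
  finally show ?thesis
    by (simp add: worker_avg_mult dispersion_def)
qed

section \<open>Square integrable random vectors\<close>

definition square_integrable :: "'w measure \<Rightarrow> ('w \<Rightarrow> 'a::euclidean_space) \<Rightarrow> bool" where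
  "square_integrable M X \<longleftrightarrow> X \<in> borel_measurable M \<and> integrable M (\<lambda>\<omega>. (norm (X \<omega>))\<^sup>2)"

lemma square_integrableD:
  assumes "square_integrable M X"
  shows "X \<in> borel_measurable M" and "integrable M (\<lambda>\<omega>. (norm (X \<omega>))\<^sup>2)"
  using assms by (simp_all add: square_integrable_def)

lemma square_integrable_bound:
  assumes "X \<in> borel_measurable M" and "integrable M h" and "\<And>\<omega>. (norm (X \<omega>))\<^sup>2 \<le> h \<omega>"
  shows "square_integrable M X"
  unfolding square_integrable_def
proof
  show "integrable M (\<lambda>\<omega>. (norm (X \<omega>))\<^sup>2)"
  proof (rule Bochner_Integration.integrable_bound[OF assms(2)])
    show "AE \<omega> in M. norm ((norm (X \<omega>))\<^sup>2) \<le> norm (h \<omega>)"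
      using assms(3) by (intro AE_I2) (simp add: order_trans[OF _ abs_ge_self])
  qed (use assms(1) in measurable)
qed (rule assms(1))

lemma square_integrable_cong:
  assumes "\<And>\<omega>. \<omega> \<in> space M \<Longrightarrow> X \<omega> = Y \<omega>"
  shows "square_integrable M X \<longleftrightarrow> square_integrable M Y"
proof -
  have "X \<in> borel_measurable M \<longleftrightarrow> Y \<in> borel_measurable M"
    using assms by (rule measurable_cong)
  moreover have "integrable M (\<lambda>\<omega>. (norm (X \<omega>))\<^sup>2) \<longleftrightarrow> integrable M (\<lambda>\<omega>. (norm (Y \<omega>))\<^sup>2)"
    using assms by (intro Bochner_Integration.integrable_cong) auto
  ultimately show ?thesis
    by (simp add: square_integrable_def)
qed

lemma square_integrable_add:
  assumes "square_integrable M X" and "square_integrable M Y"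
  shows "square_integrable M (\<lambda>\<omega>. X \<omega> + Y \<omega>)"
proof (rule square_integrable_bound)
  show "integrable M (\<lambda>\<omega>. 2 * (norm (X \<omega>))\<^sup>2 + 2 * (norm (Y \<omega>))\<^sup>2)"
    using assms by (simp add: square_integrable_def)
  show "(norm (X \<omega> + Y \<omega>))\<^sup>2 \<le> 2 * (norm (X \<omega>))\<^sup>2 + 2 * (norm (Y \<omega>))\<^sup>2" for \<omega>
    using power_mono[OF norm_triangle_ineq[of "X \<omega>" "Y \<omega>"], of 2]
      sum_squares_bound[of "norm (X \<omega>)" "norm (Y \<omega>)"] by (simp add: power2_sum)
qed (use square_integrableD(1)[OF assms(1)] square_integrableD(1)[OF assms(2)] in simp)

lemma square_integrable_scaleR:
  assumes "square_integrable M X"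
  shows "square_integrable M (\<lambda>\<omega>. r *\<^sub>R X \<omega>)"
  using square_integrableD[OF assms] by (simp add: square_integrable_def power_mult_distrib)

lemma square_integrable_diff:
  assumes "square_integrable M X" and "square_integrable M Y"
  shows "square_integrable M (\<lambda>\<omega>. X \<omega> - Y \<omega>)"
  using square_integrable_add[OF assms(1) square_integrable_scaleR[OF assms(2), of "-1"]] by simp

lemma square_integrable_worker_avg:
  assumes "\<And>i. i \<in> {1..n} \<Longrightarrow> square_integrable M (X i)"
  shows "square_integrable M (\<lambda>\<omega>. worker_avg n (\<lambda>i. X i \<omega>))"
proof -
  have "square_integrable M (\<lambda>\<omega>. \<Sum>i\<in>I. X i \<omega>)" if "I \<subseteq> {1..n}" for I
    using finite_subset[OF that finite_atLeastAtMost] that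
  proof (induction I rule: finite_induct)
    case empty
    then show ?case
      by (simp add: square_integrable_def)
  qed (use assms in \<open>auto intro: square_integrable_add\<close>)
  then show ?thesis
    unfolding worker_avg_def by (intro square_integrable_scaleR) auto
qed

lemma integrable_inner:
  fixes X Y :: "'w \<Rightarrow> 'a::euclidean_space"
  assumes "square_integrable M X" and "square_integrable M Y"
  shows "integrable M (\<lambda>\<omega>. X \<omega> \<bullet> Y \<omega>)"
proof (rule Bochner_Integration.integrable_bound)
  show "integrable M (\<lambda>\<omega>. (norm (X \<omega>))\<^sup>2 + (norm (Y \<omega>))\<^sup>2)"
    using assms by (simp add: square_integrable_def)
  have "\<bar>x \<bullet> y\<bar> \<le> (norm x)\<^sup>2 + (norm y)\<^sup>2" for x y :: 'a
    using Cauchy_Schwarz_ineq2[of x y] sum_squares_bound[of "norm x" "norm y"]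
      mult_nonneg_nonneg[OF norm_ge_zero norm_ge_zero, of x y] by linarith
  then show "AE \<omega> in M. norm (X \<omega> \<bullet> Y \<omega>) \<le> norm ((norm (X \<omega>))\<^sup>2 + (norm (Y \<omega>))\<^sup>2)"
    by (intro AE_I2) simp
qed (use square_integrableD(1)[OF assms(1)] square_integrableD(1)[OF assms(2)] in simp)

lemma square_integrable_inner_const:
  assumes "square_integrable M X"
  shows "square_integrable M (\<lambda>\<omega>. X \<omega> \<bullet> b)"
proof (rule square_integrable_bound)
  show "integrable M (\<lambda>\<omega>. (norm b)\<^sup>2 * (norm (X \<omega>))\<^sup>2)"
    using assms by (simp add: square_integrable_def)
  show "(norm (X \<omega> \<bullet> b))\<^sup>2 \<le> (norm b)\<^sup>2 * (norm (X \<omega>))\<^sup>2" for \<omega>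
    using power_mono[OF Cauchy_Schwarz_ineq2[of "X \<omega>" b], of 2] by (simp add: power_mult_distrib mult.commute)
qed (use square_integrableD(1)[OF assms] in simp)

context prob_space
begin

lemma square_integrable_const: "square_integrable M (\<lambda>_. a)"
  by (simp add: square_integrable_def)

lemma square_integrable_imp_integrable:
  "square_integrable M X \<Longrightarrow> integrable M (X :: 'a \<Rightarrow> real)"
  using integrable_inner[OF _ square_integrable_const, of X 1] by simp

lemma square_integrable_Lipschitz:
  fixes f :: "'b::euclidean_space \<Rightarrow> 'c::euclidean_space"
  assumes X: "square_integrable M X" and f: "\<And>x y. norm (f x - f y) \<le> K * norm (x - y)"
    and meas: "f \<in> borel_measurable borel"
  shows "square_integrable M (\<lambda>\<omega>. f (X \<omega>))"
proof -
  have "square_integrable M (\<lambda>\<omega>. f (X \<omega>) - f 0)"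
  proof (rule square_integrable_bound)
    show "integrable M (\<lambda>\<omega>. K\<^sup>2 * (norm (X \<omega>))\<^sup>2)"
      using X by (simp add: square_integrable_def)
    show "(norm (f (X \<omega>) - f 0))\<^sup>2 \<le> K\<^sup>2 * (norm (X \<omega>))\<^sup>2" for \<omega>
      using power_mono[OF f[of "X \<omega>" 0], of 2] by (simp add: power_mult_distrib)
    show "(\<lambda>\<omega>. f (X \<omega>) - f 0) \<in> borel_measurable M"
      using measurable_compose[OF square_integrableD(1)[OF X] meas] by simp
  qed
  from square_integrable_add[OF this square_integrable_const[of "f 0"]] show ?thesis
    by simp
qed

lemma expectation_worker_avg:
  fixes f :: "nat \<Rightarrow> 'a \<Rightarrow> real"
  assumes "\<And>i. i \<in> {1..n} \<Longrightarrow> integrable M (f i)"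
  shows "integrable M (\<lambda>\<omega>. worker_avg n (\<lambda>i. f i \<omega>))"
    and "expectation (\<lambda>\<omega>. worker_avg n (\<lambda>i. f i \<omega>)) = worker_avg n (\<lambda>i. expectation (f i))"
proof -
  have sum_int: "integrable M (\<lambda>\<omega>. \<Sum>i = 1..n. f i \<omega>)"
    using assms by (rule Bochner_Integration.integrable_sum)
  then show "integrable M (\<lambda>\<omega>. worker_avg n (\<lambda>i. f i \<omega>))"
    unfolding worker_avg_def by (rule integrable_scaleR_right)
  show "expectation (\<lambda>\<omega>. worker_avg n (\<lambda>i. f i \<omega>)) = worker_avg n (\<lambda>i. expectation (f i))"
    unfolding worker_avg_def integral_scaleR_right
    using Bochner_Integration.integral_sum[of "{1..n}" M f] assms by simp
qed

end

section \<open>Orthogonality from conditional centring and independence\<close>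

context prob_space
begin

lemma sigma_finite_subalgebraI: "subalgebra M G \<Longrightarrow> sigma_finite_subalgebra M G"
  by (intro finite_measure_subalgebra_is_sigma_finite finite_measure_subalgebra.intro
      finite_measure_subalgebra_axioms.intro finite_measure_axioms)

text \<open>The hypothesis on events says that the conditional expectation of \<open>Z\<close> given \<open>X\<close> vanishes, so \<open>Z\<close> is
  orthogonal to every function of \<open>X\<close>.\<close>

lemma expectation_mult_eq_0_if_eq_0_on_events:
  fixes X :: "'a \<Rightarrow> 'b::topological_space" and Z :: "'a \<Rightarrow> real" and f :: "'b \<Rightarrow> real"
  assumes X: "X \<in> borel_measurable M" and Z: "integrable M Z"
    and events: "\<And>A. A \<in> sets borel \<Longrightarrow> expectation (\<lambda>\<omega>. indicator (X -` A \<inter> space M) \<omega> * Z \<omega>) = 0"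
    and f: "f \<in> borel_measurable borel" and int: "integrable M (\<lambda>\<omega>. f (X \<omega>) * Z \<omega>)"
  shows "expectation (\<lambda>\<omega>. f (X \<omega>) * Z \<omega>) = 0"
proof -
  define G where "G = vimage_algebra (space M) X borel"
  have G_sets: "sets G = {X -` A \<inter> space M | A. A \<in> sets borel}"
    unfolding G_def by (rule sets_vimage_algebra2) simp
  have "subalgebra M G"
    unfolding subalgebra_def using measurable_sets[OF X] by (auto simp: G_sets) (auto simp: G_def)
  then interpret sigma_finite_subalgebra M G
    by (rule sigma_finite_subalgebraI)
  have "X \<in> borel_measurable G"
    unfolding G_def by (rule measurable_vimage_algebra1) simp
  then have fX: "(\<lambda>\<omega>. f (X \<omega>)) \<in> borel_measurable G"
    using f by (rule measurable_compose)
  have "AE \<omega> in M. real_cond_exp M G Z \<omega> = 0"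
  proof (rule real_cond_exp_charact)
    show "(\<integral>\<omega>\<in>A. Z \<omega> \<partial>M) = (\<integral>\<omega>\<in>A. 0 \<partial>M)" if "A \<in> sets G" for A
      using that events by (auto simp: G_sets set_lebesgue_integral_def)
  qed (use Z in auto)
  then have "expectation (\<lambda>\<omega>. f (X \<omega>) * real_cond_exp M G Z \<omega>) = expectation (\<lambda>_. 0)"
    by (intro integral_cong_AE) (use fX measurable_from_subalg[OF subalg fX] in auto)
  then show ?thesis
    using real_cond_exp_intg(2)[OF int fX] Z by simp
qed

lemma vec_cond_exp_eq_0D:
  assumes "AE \<omega> in M. vec_cond_exp M G X \<omega> = 0" and "b \<in> Basis"
  shows "AE \<omega> in M. real_cond_exp M G (\<lambda>\<omega>. X \<omega> \<bullet> b) \<omega> = 0"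
  using assms(1)
proof (rule AE_mp, intro AE_I2 impI)
  fix \<omega>
  assume "vec_cond_exp M G X \<omega> = 0"
  then have "vec_cond_exp M G X \<omega> \<bullet> b = 0"
    by simp
  then show "real_cond_exp M G (\<lambda>\<omega>. X \<omega> \<bullet> b) \<omega> = 0"
    using assms(2) by (simp add: vec_cond_exp_def)
qed

lemma expectation_inner_eq_0_if_conditionally_centred:
  assumes "subalgebra M G" and X: "square_integrable M X" and centred: "AE \<omega> in M. vec_cond_exp M G X \<omega> = 0"
    and Z: "square_integrable M Z" and Z_meas: "Z \<in> borel_measurable G"
  shows "expectation (\<lambda>\<omega>. Z \<omega> \<bullet> X \<omega>) = 0"
proof -
  interpret sigma_finite_subalgebra M G
    using assms(1) by (rule sigma_finite_subalgebraI)
  note comp = square_integrable_inner_const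
  have int: "integrable M (\<lambda>\<omega>. (Z \<omega> \<bullet> b) * (X \<omega> \<bullet> b))" for b
    using integrable_inner[OF comp[OF Z] comp[OF X], of b b] by simp
  have "expectation (\<lambda>\<omega>. (Z \<omega> \<bullet> b) * (X \<omega> \<bullet> b)) = 0" if b: "b \<in> Basis" for b
  proof -
    have Zb: "(\<lambda>\<omega>. Z \<omega> \<bullet> b) \<in> borel_measurable G"
      using Z_meas by simp
    have "expectation (\<lambda>\<omega>. (Z \<omega> \<bullet> b) * real_cond_exp M G (\<lambda>\<omega>. X \<omega> \<bullet> b) \<omega>) = expectation (\<lambda>_. 0)"
      using vec_cond_exp_eq_0D[OF centred b] measurable_from_subalg[OF subalg Zb]
      by (intro integral_cong_AE) auto
    then show ?thesis
      using real_cond_exp_intg(2)[OF int Zb] square_integrableD(1)[OF X] by simp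
  qed
  note components = this
  have "expectation (\<lambda>\<omega>. Z \<omega> \<bullet> X \<omega>) = (\<Sum>b\<in>Basis. expectation (\<lambda>\<omega>. (Z \<omega> \<bullet> b) * (X \<omega> \<bullet> b)))"
    by (subst euclidean_inner) (rule Bochner_Integration.integral_sum, rule int)
  also have "\<dots> = 0"
    using components by (rule sum.neutral[OF ballI])
  finally show ?thesis .
qed

text \<open>Conditional independence speaks about events only. Fix a coordinate \<open>b\<close> and an event \<open>Y\<close> of
  \<open>e j\<close> with conditional probability \<open>p\<close>. The factorization says that \<open>Y - p\<close> is orthogonal to all events of
  \<open>e i\<close>, hence to \<open>e i \<bullet> b\<close>; as \<open>p\<close> is measurable in the conditioning algebra and \<open>e i\<close> is centred,
  \<open>e i \<bullet> b\<close> is orthogonal to \<open>Y\<close>. Since \<open>Y\<close> was an arbitrary event of \<open>e j\<close>, it is orthogonal to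
  \<open>e j \<bullet> b\<close>. Both times \<open>expectation_mult_eq_0_if_eq_0_on_events\<close> passes from events to functions.\<close>

lemma expectation_inner_eq_0_if_conditionally_independent:
  fixes e :: "'i \<Rightarrow> 'a \<Rightarrow> 'b::euclidean_space"
  assumes "subalgebra M G" and indep: "cond_indep_vars M G (\<lambda>_. borel) e I"
    and ij: "i \<in> I" "j \<in> I" "i \<noteq> j"
    and sqi: "square_integrable M (e i)" "square_integrable M (e j)"
    and centred: "AE \<omega> in M. vec_cond_exp M G (e i) \<omega> = 0"
  shows "expectation (\<lambda>\<omega>. e i \<omega> \<bullet> e j \<omega>) = 0"
proof -
  interpret sigma_finite_subalgebra M G
    using assms(1) by (rule sigma_finite_subalgebraI)
  note comp = square_integrable_inner_const
  note [measurable] = square_integrableD(1)[OF sqi(1)] square_integrableD(1)[OF sqi(2)]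
  have int: "integrable M (\<lambda>\<omega>. (e i \<omega> \<bullet> b) * (e j \<omega> \<bullet> b))" for b
    using integrable_inner[OF comp[OF sqi(1)] comp[OF sqi(2)], of b b] by simp
  have "expectation (\<lambda>\<omega>. (e i \<omega> \<bullet> b) * (e j \<omega> \<bullet> b)) = 0" if b: "b \<in> Basis" for b
  proof -
    have Xb: "integrable M (\<lambda>\<omega>. e i \<omega> \<bullet> b)"
      using square_integrable_imp_integrable[OF comp[OF sqi(1)]] .
    have on_events: "expectation (\<lambda>\<omega>. indicator (e j -` B \<inter> space M) \<omega> * (e i \<omega> \<bullet> b)) = 0"
      if B[measurable]: "B \<in> sets borel" for B
    proof -
      define Y :: "'a \<Rightarrow> real" where "Y = indicator (e j -` B \<inter> space M)"
      define p where "p = real_cond_exp M G Y"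
      have Y_int: "integrable M Y"
        unfolding Y_def by (simp add: integrable_real_indicator less_top[symmetric])
      have p_meas: "p \<in> borel_measurable G" "p \<in> borel_measurable M"
        unfolding p_def by auto
      have p_int: "integrable M p"
        unfolding p_def using Y_int by (rule real_cond_exp_int)
      have p_bounded: "AE \<omega> in M. \<bar>p \<omega>\<bar> \<le> 1"
        using real_cond_exp_ge_c[OF Y_int, of 0] real_cond_exp_le_c[OF Y_int, of 1]
        by (auto simp: Y_def p_def indicator_def)
      have pX_int: "integrable M (\<lambda>\<omega>. p \<omega> * (e i \<omega> \<bullet> b))"
      proof (rule Bochner_Integration.integrable_bound[OF Xb])
        show "AE \<omega> in M. norm (p \<omega> * (e i \<omega> \<bullet> b)) \<le> norm (e i \<omega> \<bullet> b)"
          using p_bounded by (rule AE_mp) (auto simp: abs_mult intro!: AE_I2 mult_left_le_one_le)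
      qed (use p_meas in measurable)
      have YX_int: "integrable M (\<lambda>\<omega>. Y \<omega> * (e i \<omega> \<bullet> b))"
        unfolding Y_def mult.commute[of "indicator _ _"] by (rule integrable_real_mult_indicator[OF _ Xb]) measurable
      have "expectation (\<lambda>\<omega>. indicator (e i -` A \<inter> space M) \<omega> * (Y \<omega> - p \<omega>)) = 0"
        if A[measurable]: "A \<in> sets borel" for A
      proof -
        define Z :: "'a \<Rightarrow> real" where "Z = indicator (e i -` A \<inter> space M)"
        have Z_int: "integrable M Z"
          unfolding Z_def by (simp add: integrable_real_indicator less_top[symmetric])
        have [measurable]: "Z \<in> borel_measurable M"
          using Z_int by simp
        have ZY_int: "integrable M (\<lambda>\<omega>. Z \<omega> * Y \<omega>)"
          unfolding Z_def mult.commute[of "indicator _ _"] by (rule integrable_real_mult_indicator[OF _ Y_int]) measurable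
        have Zp_int: "integrable M (\<lambda>\<omega>. p \<omega> * Z \<omega>)"
          unfolding Z_def by (rule integrable_real_mult_indicator[OF _ p_int]) measurable
        have "AE \<omega> in M. real_cond_exp M G (indicator (\<Inter>k\<in>{i, j}. e k -` (if k = i then A else B) \<inter> space M)) \<omega>
            = (\<Prod>k\<in>{i, j}. real_cond_exp M G (indicator (e k -` (if k = i then A else B) \<inter> space M)) \<omega>)"
          using indep ij unfolding cond_indep_vars_def
          by (elim conjE allE[of _ "{i, j}"] allE[of _ "\<lambda>k. if k = i then A else B"]) auto
        moreover have "indicator (\<Inter>k\<in>{i, j}. e k -` (if k = i then A else B) \<inter> space M) = (\<lambda>\<omega>. Z \<omega> * Y \<omega>)"
          using ij by (auto simp: fun_eq_iff Z_def Y_def indicator_def)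
        ultimately have factor: "AE \<omega> in M. real_cond_exp M G (\<lambda>\<omega>. Z \<omega> * Y \<omega>) \<omega> = p \<omega> * real_cond_exp M G Z \<omega>"
          using ij by (simp add: Z_def Y_def p_def mult.commute)
        have "expectation (\<lambda>\<omega>. Z \<omega> * Y \<omega>) = expectation (real_cond_exp M G (\<lambda>\<omega>. Z \<omega> * Y \<omega>))"
          using real_cond_exp_int(2)[OF ZY_int] by simp
        also have "\<dots> = expectation (\<lambda>\<omega>. p \<omega> * real_cond_exp M G Z \<omega>)"
        proof (rule integral_cong_AE[OF _ _ factor])
          show "(\<lambda>\<omega>. p \<omega> * real_cond_exp M G Z \<omega>) \<in> borel_measurable M"
            using p_meas(2) by (intro borel_measurable_times borel_measurable_cond_exp2)
        qed (rule borel_measurable_cond_exp2)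
        also have "\<dots> = expectation (\<lambda>\<omega>. p \<omega> * Z \<omega>)"
          using real_cond_exp_intg(2)[OF Zp_int p_meas(1)] by simp
        finally show ?thesis
          using ZY_int Zp_int unfolding Z_def[symmetric] by (simp add: right_diff_distrib mult.commute)
      qed
      note events_A = this
      have expand: "(\<lambda>\<omega>. (e i \<omega> \<bullet> b) * (Y \<omega> - p \<omega>))
          = (\<lambda>\<omega>. Y \<omega> * (e i \<omega> \<bullet> b) - p \<omega> * (e i \<omega> \<bullet> b))"
        by (simp add: fun_eq_iff algebra_simps)
      have "expectation (\<lambda>\<omega>. (e i \<omega> \<bullet> b) * (Y \<omega> - p \<omega>)) = 0"
      proof (rule expectation_mult_eq_0_if_eq_0_on_events[of "e i" _ "\<lambda>x. x \<bullet> b",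
            OF square_integrableD(1)[OF sqi(1)] _ events_A])
        show "integrable M (\<lambda>\<omega>. Y \<omega> - p \<omega>)"
          using Y_int p_int by (rule Bochner_Integration.integrable_diff)
        show "integrable M (\<lambda>\<omega>. (e i \<omega> \<bullet> b) * (Y \<omega> - p \<omega>))"
          unfolding expand using YX_int pX_int by (rule Bochner_Integration.integrable_diff)
      qed simp_all
      then have "expectation (\<lambda>\<omega>. Y \<omega> * (e i \<omega> \<bullet> b)) = expectation (\<lambda>\<omega>. p \<omega> * (e i \<omega> \<bullet> b))"
        using YX_int pX_int by (simp add: expand)
      also have "\<dots> = expectation (\<lambda>\<omega>. p \<omega> * real_cond_exp M G (\<lambda>\<omega>. e i \<omega> \<bullet> b) \<omega>)"
        using real_cond_exp_intg(2)[OF pX_int p_meas(1)] by simp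
      also have "\<dots> = expectation (\<lambda>_. 0)"
      proof (rule integral_cong_AE)
        show "(\<lambda>\<omega>. p \<omega> * real_cond_exp M G (\<lambda>\<omega>. e i \<omega> \<bullet> b) \<omega>) \<in> borel_measurable M"
          using p_meas(2) by (intro borel_measurable_times borel_measurable_cond_exp2)
        show "AE \<omega> in M. p \<omega> * real_cond_exp M G (\<lambda>\<omega>. e i \<omega> \<bullet> b) \<omega> = 0"
          using vec_cond_exp_eq_0D[OF centred b] by (rule AE_mp) (simp add: AE_I2)
      qed simp
      finally show ?thesis
        by (simp add: Y_def)
    qed
    have "expectation (\<lambda>\<omega>. (e j \<omega> \<bullet> b) * (e i \<omega> \<bullet> b)) = 0"
    proof (rule expectation_mult_eq_0_if_eq_0_on_events[of "e j" _ "\<lambda>x. x \<bullet> b", OF square_integrableD(1)[OF sqi(2)] Xb on_events])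
      show "integrable M (\<lambda>\<omega>. (e j \<omega> \<bullet> b) * (e i \<omega> \<bullet> b))"
        using int[of b] by (simp only: mult.commute)
    qed simp_all
    then show ?thesis
      by (simp add: mult.commute)
  qed
  note components = this
  have "expectation (\<lambda>\<omega>. e i \<omega> \<bullet> e j \<omega>) = (\<Sum>b\<in>Basis. expectation (\<lambda>\<omega>. (e i \<omega> \<bullet> b) * (e j \<omega> \<bullet> b)))"
    by (subst euclidean_inner) (rule Bochner_Integration.integral_sum, rule int)
  also have "\<dots> = 0"
    using components by (rule sum.neutral[OF ballI])
  finally show ?thesis .
qed

text \<open>Integrability is part of the conclusion: the conditional expectation of a nonnegative variable
  integrates to the same value even if that value is infinite.\<close>

lemma conditional_second_moment_bound:
  assumes "subalgebra M G" and X: "X \<in> borel_measurable M"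
    and bound: "AE \<omega> in M. nn_cond_exp M G (\<lambda>\<omega>. ennreal ((norm (X \<omega>))\<^sup>2)) \<omega> \<le> ennreal (h \<omega>)"
    and h: "integrable M h" "\<And>\<omega>. 0 \<le> h \<omega>"
  shows "square_integrable M X" and "expectation (\<lambda>\<omega>. (norm (X \<omega>))\<^sup>2) \<le> expectation h"
proof -
  interpret sigma_finite_subalgebra M G
    using assms(1) by (rule sigma_finite_subalgebraI)
  have "(\<integral>\<^sup>+ \<omega>. ennreal ((norm (X \<omega>))\<^sup>2) \<partial>M) = (\<integral>\<^sup>+ \<omega>. nn_cond_exp M G (\<lambda>\<omega>. ennreal ((norm (X \<omega>))\<^sup>2)) \<omega> \<partial>M)"
    using nn_cond_exp_intg[of "\<lambda>_. 1" "\<lambda>\<omega>. ennreal ((norm (X \<omega>))\<^sup>2)"] X by simp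
  also have "\<dots> \<le> (\<integral>\<^sup>+ \<omega>. ennreal (h \<omega>) \<partial>M)"
    using bound by (rule nn_integral_mono_AE)
  also have "\<dots> = ennreal (expectation h)"
    using h by (intro nn_integral_eq_integral) auto
  finally have le: "(\<integral>\<^sup>+ \<omega>. ennreal ((norm (X \<omega>))\<^sup>2) \<partial>M) \<le> ennreal (expectation h)" .
  then have "integrable M (\<lambda>\<omega>. (norm (X \<omega>))\<^sup>2)"
    using X by (intro integrableI_bounded) (auto intro: le_less_trans)
  then show sqi: "square_integrable M X"
    using X by (simp add: square_integrable_def)
  have "ennreal (expectation (\<lambda>\<omega>. (norm (X \<omega>))\<^sup>2)) \<le> ennreal (expectation h)"
    using le square_integrableD(2)[OF sqi] by (simp add: nn_integral_eq_integral)
  then show "expectation (\<lambda>\<omega>. (norm (X \<omega>))\<^sup>2) \<le> expectation h"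
    using h by (subst (asm) ennreal_le_iff) (auto intro: integral_nonneg)
qed

end

section \<open>One noisy gradient step\<close>

text \<open>\<open>F\<close> lies between its minimum and a quadratic function.\<close>

lemma (in prob_space) integrable_objective:
  fixes X :: "'a \<Rightarrow> 'b::euclidean_space"
  assumes scs: "strongly_convex_smooth \<mu> L F gradF" and \<mu>: "0 < \<mu>" "\<mu> \<le> L" and X: "square_integrable M X"
  shows "integrable M (\<lambda>\<omega>. F (X \<omega>))"
proof -
  have "integrable M (\<lambda>\<omega>. X \<omega> \<bullet> gradF 0)"
    using integrable_inner[OF X square_integrable_const] .
  then have "integrable M (\<lambda>\<omega>. \<bar>F 0\<bar> + \<bar>X \<omega> \<bullet> gradF 0\<bar> + L / 2 * (norm (X \<omega>))\<^sup>2 + \<bar>min_value F\<bar>)"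
    using square_integrableD(2)[OF X] by simp
  then show ?thesis
  proof (rule Bochner_Integration.integrable_bound)
    have "norm (F v) \<le> norm (\<bar>F 0\<bar> + \<bar>v \<bullet> gradF 0\<bar> + L / 2 * (norm v)\<^sup>2 + \<bar>min_value F\<bar>)" for v
    proof -
      have "0 \<le> L / 2 * (norm v)\<^sup>2"
        using \<mu> by simp
      then show ?thesis
        using quadratic_upper_bound[OF scs \<mu>, of v 0] min_value_le[OF scs \<mu>, of v] min_value_le[OF scs \<mu>, of 0]
        by (simp add: inner_commute)
    qed
    then show "AE \<omega> in M. norm (F (X \<omega>))
        \<le> norm (\<bar>F 0\<bar> + \<bar>X \<omega> \<bullet> gradF 0\<bar> + L / 2 * (norm (X \<omega>))\<^sup>2 + \<bar>min_value F\<bar>)"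
      by (intro AE_I2)
    show "(\<lambda>\<omega>. F (X \<omega>)) \<in> borel_measurable M"
      by (rule measurable_compose[OF square_integrableD(1)[OF X] borel_measurable_continuous_onI[OF continuous_on_objective[OF scs \<mu>]]])
  qed
qed

text \<open>The workers sit at \<open>y i\<close>, known from \<open>G\<close>, and receive the gradients there with errors \<open>e i\<close>. The
  noise bound is the one that remains after taking expectations.\<close>

locale noisy_gradient_step = prob_space M for M :: "'w measure" +
  fixes G :: "'w measure" and \<mu> L c \<sigma> :: real and F :: "'a::euclidean_space \<Rightarrow> real"
    and gradF :: "'a \<Rightarrow> 'a" and n :: nat and y e :: "nat \<Rightarrow> 'w \<Rightarrow> 'a"
  assumes scs: "strongly_convex_smooth \<mu> L F gradF" and \<mu>_pos: "0 < \<mu>" and \<mu>_le_L: "\<mu> \<le> L"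
    and n_pos: "1 \<le> n"
    and subalg: "subalgebra M G"
    and y_sqi: "\<And>i. i \<in> {1..n} \<Longrightarrow> square_integrable M (y i)"
    and y_meas: "\<And>i. i \<in> {1..n} \<Longrightarrow> y i \<in> borel_measurable G"
    and e_sqi: "\<And>i. i \<in> {1..n} \<Longrightarrow> square_integrable M (e i)"
    and e_bound: "\<And>i. i \<in> {1..n} \<Longrightarrow> expectation (\<lambda>\<omega>. (norm (e i \<omega>))\<^sup>2)
        \<le> c * expectation (\<lambda>\<omega>. (norm (gradF (y i \<omega>)))\<^sup>2) + \<sigma>\<^sup>2"
    and e_centred: "\<And>i. i \<in> {1..n} \<Longrightarrow> AE \<omega> in M. vec_cond_exp M G (e i) \<omega> = 0"
    and e_indep: "cond_indep_vars M G (\<lambda>_. borel) e {1..n}"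
begin

abbreviation "noise \<equiv> worker_avg n (\<lambda>i. expectation (\<lambda>\<omega>. (norm (e i \<omega>))\<^sup>2))"

abbreviation "grads \<equiv> worker_avg n (\<lambda>i. expectation (\<lambda>\<omega>. (norm (gradF (y i \<omega>)))\<^sup>2))"

lemma gradF_measurable: "gradF \<in> borel_measurable borel"
  using continuous_on_gradient[OF scs \<mu>_pos \<mu>_le_L] by (rule borel_measurable_continuous_onI)

lemma square_integrable_gradF:
  "square_integrable M X \<Longrightarrow> square_integrable M (\<lambda>\<omega>. gradF (X \<omega>))"
  by (rule square_integrable_Lipschitz[OF _ gradient_Lipschitz[OF scs \<mu>_pos \<mu>_le_L] gradF_measurable])

lemma worker_avg_measurable:
  assumes "\<And>i. i \<in> {1..n} \<Longrightarrow> X i \<in> borel_measurable N"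
  shows "(\<lambda>\<omega>. worker_avg n (\<lambda>i. X i \<omega> :: 'a)) \<in> borel_measurable N"
  unfolding worker_avg_def
  using assms by (intro borel_measurable_scaleR borel_measurable_sum borel_measurable_const) auto

lemma square_integrable_avg_noise: "square_integrable M (\<lambda>\<omega>. worker_avg n (\<lambda>i. e i \<omega>))"
  using e_sqi by (rule square_integrable_worker_avg)

lemma square_integrable_avg: "square_integrable M (\<lambda>\<omega>. worker_avg n (\<lambda>i. y i \<omega>))"
  using y_sqi by (rule square_integrable_worker_avg)

lemma integrable_dispersion:
  assumes "\<And>i. i \<in> {1..n} \<Longrightarrow> square_integrable M (X i)"
  shows "integrable M (\<lambda>\<omega>. dispersion n (\<lambda>i. X i \<omega> :: 'a))"
  unfolding dispersion_def
  using assms by (intro expectation_worker_avg(1) square_integrableD(2) square_integrable_diff square_integrable_worker_avg)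

lemma noise_le: "noise \<le> c * grads + \<sigma>\<^sup>2"
proof -
  have "noise \<le> worker_avg n (\<lambda>i. c * expectation (\<lambda>\<omega>. (norm (gradF (y i \<omega>)))\<^sup>2) + \<sigma>\<^sup>2)"
    using e_bound by (rule worker_avg_mono)
  also have "\<dots> = c * grads + \<sigma>\<^sup>2"
    using n_pos by (simp add: worker_avg_add worker_avg_mult worker_avg_const)
  finally show ?thesis .
qed

text \<open>Conditional independence removes the cross terms of the squared norm.\<close>

lemma avg_noise_second_moment: "expectation (\<lambda>\<omega>. (norm (worker_avg n (\<lambda>i. e i \<omega>)))\<^sup>2) = noise / n"
proof -
  have int: "integrable M (\<lambda>\<omega>. e i \<omega> \<bullet> e j \<omega>)" if "i \<in> {1..n}" "j \<in> {1..n}" for i j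
    using e_sqi that by (intro integrable_inner)
  have cross: "expectation (\<lambda>\<omega>. e i \<omega> \<bullet> e j \<omega>) = (if j = i then expectation (\<lambda>\<omega>. (norm (e i \<omega>))\<^sup>2) else 0)"
    if "i \<in> {1..n}" "j \<in> {1..n}" for i j
    using that expectation_inner_eq_0_if_conditionally_independent[OF subalg e_indep _ _ _ e_sqi e_sqi e_centred]
    by (auto simp: power2_norm_eq_inner)
  have "(norm (worker_avg n (\<lambda>i. e i \<omega>)))\<^sup>2 = (1 / real n)\<^sup>2 * (\<Sum>i = 1..n. \<Sum>j = 1..n. e i \<omega> \<bullet> e j \<omega>)" for \<omega>
  proof -
    have "(norm (\<Sum>i = 1..n. e i \<omega>))\<^sup>2 = (\<Sum>i = 1..n. \<Sum>j = 1..n. e i \<omega> \<bullet> e j \<omega>)"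
      unfolding power2_norm_eq_inner inner_sum_left inner_sum_right by (intro sum.cong refl inner_commute)
    then show ?thesis
      by (simp add: worker_avg_def power_divide)
  qed
  then have "expectation (\<lambda>\<omega>. (norm (worker_avg n (\<lambda>i. e i \<omega>)))\<^sup>2)
      = expectation (\<lambda>\<omega>. (1 / real n)\<^sup>2 * (\<Sum>i = 1..n. \<Sum>j = 1..n. e i \<omega> \<bullet> e j \<omega>))"
    by simp
  also have "\<dots> = (1 / real n)\<^sup>2 * (\<Sum>i = 1..n. \<Sum>j = 1..n. expectation (\<lambda>\<omega>. e i \<omega> \<bullet> e j \<omega>))"
  proof -
    have "expectation (\<lambda>\<omega>. \<Sum>i = 1..n. \<Sum>j = 1..n. e i \<omega> \<bullet> e j \<omega>)
        = (\<Sum>i = 1..n. expectation (\<lambda>\<omega>. \<Sum>j = 1..n. e i \<omega> \<bullet> e j \<omega>))"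
      by (intro Bochner_Integration.integral_sum Bochner_Integration.integrable_sum int)
    also have "\<dots> = (\<Sum>i = 1..n. \<Sum>j = 1..n. expectation (\<lambda>\<omega>. e i \<omega> \<bullet> e j \<omega>))"
      by (intro sum.cong refl Bochner_Integration.integral_sum int)
    finally show ?thesis
      by simp
  qed
  also have "\<dots> = (1 / real n)\<^sup>2 * (\<Sum>i = 1..n. \<Sum>j = 1..n. if j = i then expectation (\<lambda>\<omega>. (norm (e i \<omega>))\<^sup>2) else 0)"
    using cross by simp
  also have "\<dots> = noise / n"
    by (simp add: worker_avg_def power2_eq_square)
  finally show ?thesis .
qed

lemma dispersion_noise_expectation:
  "expectation (\<lambda>\<omega>. dispersion n (\<lambda>i. e i \<omega>)) = (1 - 1 / n) * noise"
proof -
  have "dispersion n (\<lambda>i. e i \<omega>)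
      = worker_avg n (\<lambda>i. (norm (e i \<omega>))\<^sup>2) - (norm (worker_avg n (\<lambda>i. e i \<omega>)))\<^sup>2" for \<omega>
    using dispersion_about[OF n_pos, of "\<lambda>i. e i \<omega>" 0] by simp
  then have "expectation (\<lambda>\<omega>. dispersion n (\<lambda>i. e i \<omega>)) = noise - noise / n"
    using expectation_worker_avg[of n "\<lambda>i \<omega>. (norm (e i \<omega>))\<^sup>2"] square_integrableD(2)[OF e_sqi]
      square_integrableD(2)[OF square_integrable_avg_noise]
    by (simp add: avg_noise_second_moment)
  then show ?thesis
    by (simp add: left_diff_distrib)
qed

text \<open>The exact gradient step contracts the dispersion, and the noise adds its own dispersion because it is
  orthogonal to everything known from \<open>G\<close>.\<close>

lemma expected_dispersion_after_step:
  assumes r: "0 \<le> r" "r * L\<^sup>2 \<le> \<mu>"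
  shows "expectation (\<lambda>\<omega>. dispersion n (\<lambda>i. y i \<omega> - r *\<^sub>R (gradF (y i \<omega>) + e i \<omega>)))
    \<le> (1 - r * \<mu>) * expectation (\<lambda>\<omega>. dispersion n (\<lambda>i. y i \<omega>)) + r\<^sup>2 * (1 - 1 / n) * (c * grads + \<sigma>\<^sup>2)"
proof -
  define p where "p i \<omega> = y i \<omega> - r *\<^sub>R gradF (y i \<omega>)" for i \<omega>
  let ?q = "\<lambda>i \<omega>. p i \<omega> - worker_avg n (\<lambda>j. p j \<omega>)"
  have p_sqi: "square_integrable M (p i)" if "i \<in> {1..n}" for i
    unfolding p_def using y_sqi[OF that]
    by (intro square_integrable_diff square_integrable_scaleR square_integrable_gradF)
  then have q_sqi: "square_integrable M (?q i)" if "i \<in> {1..n}" for i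
    using that by (intro square_integrable_diff square_integrable_worker_avg)
  have p_meas: "p i \<in> borel_measurable G" if "i \<in> {1..n}" for i
    unfolding p_def using y_meas[OF that] measurable_compose[OF y_meas[OF that] gradF_measurable]
    by (intro borel_measurable_diff borel_measurable_scaleR borel_measurable_const)
  have q_meas: "?q i \<in> borel_measurable G" if "i \<in> {1..n}" for i
    using that p_meas by (intro borel_measurable_diff worker_avg_measurable)
  have cross_int: "integrable M (\<lambda>\<omega>. ?q i \<omega> \<bullet> e i \<omega>)" if "i \<in> {1..n}" for i
    using q_sqi[OF that] e_sqi[OF that] by (rule integrable_inner)
  have cross: "expectation (\<lambda>\<omega>. ?q i \<omega> \<bullet> e i \<omega>) = 0" if "i \<in> {1..n}" for i
    using subalg e_sqi[OF that] e_centred[OF that] q_sqi[OF that] q_meas[OF that]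
    by (rule expectation_inner_eq_0_if_conditionally_centred)
  have "y i \<omega> - r *\<^sub>R (gradF (y i \<omega>) + e i \<omega>) = p i \<omega> - r *\<^sub>R e i \<omega>" for i \<omega>
    by (simp add: p_def scaleR_add_right)
  then have "expectation (\<lambda>\<omega>. dispersion n (\<lambda>i. y i \<omega> - r *\<^sub>R (gradF (y i \<omega>) + e i \<omega>)))
      = expectation (\<lambda>\<omega>. dispersion n (\<lambda>i. p i \<omega>) - 2 * r * worker_avg n (\<lambda>i. ?q i \<omega> \<bullet> e i \<omega>)
          + r\<^sup>2 * dispersion n (\<lambda>i. e i \<omega>))"
    by (simp add: dispersion_diff[OF n_pos])
  also have "\<dots> = expectation (\<lambda>\<omega>. dispersion n (\<lambda>i. p i \<omega>)) - 2 * r * worker_avg n (\<lambda>i. expectation (\<lambda>\<omega>. ?q i \<omega> \<bullet> e i \<omega>))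
      + r\<^sup>2 * expectation (\<lambda>\<omega>. dispersion n (\<lambda>i. e i \<omega>))"
    using integrable_dispersion[OF p_sqi] integrable_dispersion[OF e_sqi]
      expectation_worker_avg[of n "\<lambda>i \<omega>. ?q i \<omega> \<bullet> e i \<omega>", OF cross_int] by simp
  also have "worker_avg n (\<lambda>i. expectation (\<lambda>\<omega>. ?q i \<omega> \<bullet> e i \<omega>)) = 0"
    using cross by (simp add: worker_avg_def)
  finally have "expectation (\<lambda>\<omega>. dispersion n (\<lambda>i. y i \<omega> - r *\<^sub>R (gradF (y i \<omega>) + e i \<omega>)))
      = expectation (\<lambda>\<omega>. dispersion n (\<lambda>i. p i \<omega>)) + r\<^sup>2 * (1 - 1 / n) * noise"
    by (simp add: dispersion_noise_expectation)
  moreover have "expectation (\<lambda>\<omega>. dispersion n (\<lambda>i. p i \<omega>)) \<le> expectation (\<lambda>\<omega>. (1 - r * \<mu>) * dispersion n (\<lambda>i. y i \<omega>))"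
    using integrable_dispersion[OF p_sqi] integrable_dispersion[OF y_sqi]
      gradient_step_contracts_dispersion[OF scs \<mu>_pos \<mu>_le_L n_pos r]
    by (intro integral_mono) (auto simp: p_def)
  moreover have "r\<^sup>2 * (1 - 1 / n) * noise \<le> r\<^sup>2 * (1 - 1 / n) * (c * grads + \<sigma>\<^sup>2)"
    using noise_le n_pos by (intro mult_left_mono) auto
  ultimately show ?thesis
    by simp
qed

text \<open>By polarization, the inner product of the gradient at the average with the average gradient is half
  the squared norm of the former plus half the mean squared norm of the workers' gradients minus half the mean
  squared difference between the two, and this difference is at most \<open>L\<^sup>2\<close> times the dispersion. All
  terms linear in the noise are collected in one vector \<open>z\<close> that is known from \<open>G\<close>.\<close>

lemma expected_descent:
  assumes r: "0 \<le> r"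
  shows "expectation (\<lambda>\<omega>. F (worker_avg n (\<lambda>i. y i \<omega> - r *\<^sub>R (gradF (y i \<omega>) + e i \<omega>))))
    \<le> expectation (\<lambda>\<omega>. F (worker_avg n (\<lambda>i. y i \<omega>)))
      - r / 2 * expectation (\<lambda>\<omega>. (norm (gradF (worker_avg n (\<lambda>i. y i \<omega>))))\<^sup>2) - r / 2 * grads
      + r * L\<^sup>2 / 2 * expectation (\<lambda>\<omega>. dispersion n (\<lambda>i. y i \<omega>))
      + L * r\<^sup>2 / 2 * ((1 + c / n) * grads + \<sigma>\<^sup>2 / n)"
proof -
  define m where "m \<omega> = worker_avg n (\<lambda>i. y i \<omega>)" for \<omega>
  define a where "a \<omega> = worker_avg n (\<lambda>i. gradF (y i \<omega>))" for \<omega>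
  define b where "b \<omega> = worker_avg n (\<lambda>i. e i \<omega>)" for \<omega>
  define s where "s \<omega> = worker_avg n (\<lambda>i. (norm (gradF (y i \<omega>)))\<^sup>2)" for \<omega>
  define v where "v \<omega> = dispersion n (\<lambda>i. y i \<omega>)" for \<omega>
  define z where "z \<omega> = (L * r\<^sup>2) *\<^sub>R a \<omega> - r *\<^sub>R gradF (m \<omega>)" for \<omega>
  have L_pos: "0 < L"
    using \<mu>_pos \<mu>_le_L by simp
  have m_sqi: "square_integrable M m"
    unfolding m_def by (rule square_integrable_avg)
  have gm_sqi: "square_integrable M (\<lambda>\<omega>. gradF (m \<omega>))"
    using m_sqi by (rule square_integrable_gradF)
  have a_sqi: "square_integrable M a"
    unfolding a_def using y_sqi by (intro square_integrable_worker_avg square_integrable_gradF)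
  have b_sqi: "square_integrable M b"
    unfolding b_def by (rule square_integrable_avg_noise)
  have z_sqi: "square_integrable M z"
    unfolding z_def using a_sqi gm_sqi by (intro square_integrable_diff square_integrable_scaleR)
  have s_int: "integrable M s" and s_exp: "expectation s = grads"
    unfolding s_def using y_sqi by (intro expectation_worker_avg square_integrableD(2) square_integrable_gradF; assumption)+
  have v_int: "integrable M v"
    unfolding v_def using y_sqi by (rule integrable_dispersion)
  have next_eq: "worker_avg n (\<lambda>i. y i \<omega> - r *\<^sub>R (gradF (y i \<omega>) + e i \<omega>)) = m \<omega> - r *\<^sub>R (a \<omega> + b \<omega>)" for \<omega>
    by (simp only: worker_avg_diff worker_avg_add worker_avg_scaleR m_def a_def b_def)
  have pointwise: "F (m \<omega> - r *\<^sub>R (a \<omega> + b \<omega>)) \<le> F (m \<omega>) - r / 2 * (norm (gradF (m \<omega>)))\<^sup>2 - r / 2 * s \<omega>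
      + r * L\<^sup>2 / 2 * v \<omega> + L * r\<^sup>2 / 2 * s \<omega> + L * r\<^sup>2 / 2 * (norm (b \<omega>))\<^sup>2 + z \<omega> \<bullet> b \<omega>" for \<omega>
  proof -
    have "worker_avg n (\<lambda>i. (norm (gradF (y i \<omega>) - gradF (m \<omega>)))\<^sup>2) \<le> worker_avg n (\<lambda>i. L\<^sup>2 * (norm (y i \<omega> - m \<omega>))\<^sup>2)"
      using power_mono[OF gradient_Lipschitz[OF scs \<mu>_pos \<mu>_le_L], of _ _ 2]
      by (intro worker_avg_mono) (simp add: power_mult_distrib)
    also have "\<dots> = L\<^sup>2 * v \<omega>"
      by (simp add: worker_avg_mult v_def dispersion_def m_def)
    finally have "worker_avg n (\<lambda>i. (norm (gradF (y i \<omega>) - gradF (m \<omega>)))\<^sup>2) \<le> L\<^sup>2 * v \<omega>" .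
    moreover have "worker_avg n (\<lambda>i. (norm (gradF (y i \<omega>) - gradF (m \<omega>)))\<^sup>2)
        = s \<omega> - (norm (a \<omega>))\<^sup>2 + (norm (a \<omega> - gradF (m \<omega>)))\<^sup>2"
      using dispersion_about[OF n_pos, of "\<lambda>i. gradF (y i \<omega>)" "gradF (m \<omega>)"]
        dispersion_about[OF n_pos, of "\<lambda>i. gradF (y i \<omega>)" 0] by (simp add: s_def a_def)
    ultimately have "s \<omega> - 2 * (gradF (m \<omega>) \<bullet> a \<omega>) + (norm (gradF (m \<omega>)))\<^sup>2 \<le> L\<^sup>2 * v \<omega>"
      by (simp add: power2_norm_eq_inner inner_diff_left inner_diff_right inner_commute)
    then have "r / 2 * (s \<omega> - 2 * (gradF (m \<omega>) \<bullet> a \<omega>) + (norm (gradF (m \<omega>)))\<^sup>2) \<le> r / 2 * (L\<^sup>2 * v \<omega>)"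
      using r by (intro mult_left_mono) auto
    then have inner: "- r * (gradF (m \<omega>) \<bullet> a \<omega>) \<le> - (r / 2 * (norm (gradF (m \<omega>)))\<^sup>2) - r / 2 * s \<omega> + r * L\<^sup>2 / 2 * v \<omega>"
      by (simp add: algebra_simps)
    have "(norm (a \<omega>))\<^sup>2 \<le> s \<omega>"
      unfolding a_def s_def using n_pos by (rule norm_worker_avg_le)
    then have jensen: "L * r\<^sup>2 / 2 * (norm (a \<omega>))\<^sup>2 \<le> L * r\<^sup>2 / 2 * s \<omega>"
      using L_pos by (intro mult_left_mono) auto
    have "F (m \<omega> - r *\<^sub>R (a \<omega> + b \<omega>)) \<le> F (m \<omega>) - r * (gradF (m \<omega>) \<bullet> (a \<omega> + b \<omega>)) + L / 2 * (norm (r *\<^sub>R (a \<omega> + b \<omega>)))\<^sup>2"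
      using quadratic_upper_bound[OF scs \<mu>_pos \<mu>_le_L, of "m \<omega> - r *\<^sub>R (a \<omega> + b \<omega>)" "m \<omega>"] by simp
    also have "(norm (r *\<^sub>R (a \<omega> + b \<omega>)))\<^sup>2 = r\<^sup>2 * ((norm (a \<omega>))\<^sup>2 + 2 * (a \<omega> \<bullet> b \<omega>) + (norm (b \<omega>))\<^sup>2)"
      unfolding power2_norm_eq_inner
      by (simp add: inner_add_left inner_add_right inner_commute power2_eq_square mult.assoc)
    also have "F (m \<omega>) - r * (gradF (m \<omega>) \<bullet> (a \<omega> + b \<omega>)) + L / 2 * (r\<^sup>2 * ((norm (a \<omega>))\<^sup>2 + 2 * (a \<omega> \<bullet> b \<omega>) + (norm (b \<omega>))\<^sup>2))
        = F (m \<omega>) + - r * (gradF (m \<omega>) \<bullet> a \<omega>) + L * r\<^sup>2 / 2 * (norm (a \<omega>))\<^sup>2 + L * r\<^sup>2 / 2 * (norm (b \<omega>))\<^sup>2 + z \<omega> \<bullet> b \<omega>"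
      by (simp add: z_def inner_add_right inner_diff_left algebra_simps)
    finally show ?thesis
      using inner jensen by linarith
  qed
  have gm_meas: "(\<lambda>\<omega>. gradF (m \<omega>)) \<in> borel_measurable G"
    unfolding m_def by (rule measurable_compose[OF worker_avg_measurable[OF y_meas] gradF_measurable])
  have a_meas: "a \<in> borel_measurable G"
    unfolding a_def by (intro worker_avg_measurable measurable_compose[OF y_meas gradF_measurable])
  have z_meas: "z \<in> borel_measurable G"
    unfolding z_def using gm_meas a_meas by (intro borel_measurable_diff borel_measurable_scaleR borel_measurable_const)
  have zb: "z \<omega> \<bullet> b \<omega> = worker_avg n (\<lambda>i. z \<omega> \<bullet> e i \<omega>)" for \<omega>
    by (simp add: b_def worker_avg_inner_right)
  have "expectation (\<lambda>\<omega>. z \<omega> \<bullet> e i \<omega>) = 0" if "i \<in> {1..n}" for i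
    using subalg e_sqi[OF that] e_centred[OF that] z_sqi z_meas
    by (rule expectation_inner_eq_0_if_conditionally_centred)
  then have cross: "expectation (\<lambda>\<omega>. z \<omega> \<bullet> b \<omega>) = 0"
    unfolding zb using expectation_worker_avg(2)[of n "\<lambda>i \<omega>. z \<omega> \<bullet> e i \<omega>"] integrable_inner[OF z_sqi e_sqi]
    by (simp add: worker_avg_def)
  have ints: "integrable M (\<lambda>\<omega>. F (m \<omega>))" "integrable M (\<lambda>\<omega>. (norm (gradF (m \<omega>)))\<^sup>2)"
      "integrable M (\<lambda>\<omega>. (norm (b \<omega>))\<^sup>2)" "integrable M (\<lambda>\<omega>. z \<omega> \<bullet> b \<omega>)"
    using integrable_objective[OF scs \<mu>_pos \<mu>_le_L m_sqi] gm_sqi b_sqi integrable_inner[OF z_sqi b_sqi]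
    by (auto simp: square_integrable_def)
  have "square_integrable M (\<lambda>\<omega>. m \<omega> - r *\<^sub>R (a \<omega> + b \<omega>))"
    using m_sqi a_sqi b_sqi by (intro square_integrable_diff square_integrable_scaleR square_integrable_add)
  then have int_next: "integrable M (\<lambda>\<omega>. F (m \<omega> - r *\<^sub>R (a \<omega> + b \<omega>)))"
    by (rule integrable_objective[OF scs \<mu>_pos \<mu>_le_L])
  have "expectation (\<lambda>\<omega>. F (m \<omega> - r *\<^sub>R (a \<omega> + b \<omega>)))
      \<le> expectation (\<lambda>\<omega>. F (m \<omega>) - r / 2 * (norm (gradF (m \<omega>)))\<^sup>2 - r / 2 * s \<omega>
      + r * L\<^sup>2 / 2 * v \<omega> + L * r\<^sup>2 / 2 * s \<omega> + L * r\<^sup>2 / 2 * (norm (b \<omega>))\<^sup>2 + z \<omega> \<bullet> b \<omega>)"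
    using pointwise int_next ints s_int v_int by (intro integral_mono) auto
  also have "\<dots> = expectation (\<lambda>\<omega>. F (m \<omega>)) - r / 2 * expectation (\<lambda>\<omega>. (norm (gradF (m \<omega>)))\<^sup>2) - r / 2 * grads
      + r * L\<^sup>2 / 2 * expectation v + L * r\<^sup>2 / 2 * grads + L * r\<^sup>2 / 2 * (noise / n)"
    using ints s_int v_int cross avg_noise_second_moment by (simp add: s_exp b_def)
  finally have "expectation (\<lambda>\<omega>. F (m \<omega> - r *\<^sub>R (a \<omega> + b \<omega>)))
      \<le> expectation (\<lambda>\<omega>. F (m \<omega>)) - r / 2 * expectation (\<lambda>\<omega>. (norm (gradF (m \<omega>)))\<^sup>2) - r / 2 * grads
      + r * L\<^sup>2 / 2 * expectation v + L * r\<^sup>2 / 2 * (grads + noise / n)"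
    by (simp add: distrib_left)
  also have "L * r\<^sup>2 / 2 * (grads + noise / n) \<le> L * r\<^sup>2 / 2 * ((1 + c / n) * grads + \<sigma>\<^sup>2 / n)"
  proof (rule mult_left_mono)
    have "noise / n \<le> (c * grads + \<sigma>\<^sup>2) / n"
      using noise_le by (rule divide_right_mono) simp
    then show "grads + noise / n \<le> (1 + c / n) * grads + \<sigma>\<^sup>2 / n"
      by (simp add: add_divide_distrib distrib_right)
  qed (use L_pos in simp)
  finally show ?thesis
    unfolding next_eq by (simp add: m_def v_def)
qed

end

section \<open>The recursion over the communication rounds\<close>

text \<open>The midpoint bound \<open>ln (u + 1) - ln u \<ge> 2 / (2 u + 1)\<close> is sharp enough for the factor \<open>3 / 4\<close> already at
  \<open>u = 3\<close>, where \<open>1 / (u + 1)\<close> would fail.\<close>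

lemma drift_term_le_ln:
  fixes u \<rho> :: real
  assumes "2 \<le> u" and "\<rho> = 1 \<or> \<rho> = 3 / 4 \<and> 3 \<le> u"
  shows "4 * (u + 1) / u\<^sup>2 \<le> 9 * \<rho> * (ln (u + 1) - ln u)"
proof -
  have "4 * (u + 1) * (2 * u + 1) \<le> 18 * \<rho> * u\<^sup>2"
  proof (cases "\<rho> = 1")
    case True
    have "2 * u \<le> u * u"
      using assms(1) by (intro mult_right_mono) auto
    then have "4 + u * 12 \<le> u * (u * 10)"
      using assms(1) by linarith
    then show ?thesis
      using assms(1) True by (simp add: algebra_simps power2_eq_square)
  next
    case False
    then have "3 * u \<le> u * u" "\<rho> = 3 / 4" "3 \<le> u"
      using assms by (auto intro: mult_right_mono)
    then have "4 + u * 12 + 8 * (u * u) \<le> 27 / 2 * (u * u)"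
      by linarith
    then show ?thesis
      by (simp add: \<open>\<rho> = 3 / 4\<close> algebra_simps power2_eq_square)
  qed
  then have "4 * (u + 1) / u\<^sup>2 \<le> 9 * \<rho> * (2 / (2 * u + 1))"
    using assms(1) by (simp add: divide_simps mult.commute mult.left_commute)
  also have "2 / (2 * u + 1) \<le> ln (u + 1) - ln u"
    using ln_inverse_approx_ge[of u "u + 1"] assms(1) by simp
  then have "9 * \<rho> * (2 / (2 * u + 1)) \<le> 9 * \<rho> * (ln (u + 1) - ln u)"
    using assms(2) by (intro mult_left_mono) auto
  finally show ?thesis .
qed

text \<open>The factor \<open>\<rho> = 1\<close> is available in every round, also in the first, where \<open>a = 0\<close> and \<open>\<beta>\<close> may be as
  small as \<open>2\<close>; later rounds have \<open>a + \<beta> \<ge> 3\<close> and allow \<open>\<rho> = 3 / 4\<close>.\<close>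

lemma sum_drift_le_ln:
  fixes a b :: nat and \<beta> \<rho> :: real
  assumes "a < b" and "2 \<le> a + \<beta>" and "\<rho> = 1 \<or> \<rho> = 3 / 4 \<and> 3 \<le> a + \<beta>"
  shows "(\<Sum>t\<in>{a<..<b}. 4 * (t + \<beta>) / (t + \<beta> - 1)\<^sup>2)
    \<le> 9 * \<rho> * ln (1 + (real (b - a) - 1) / (a + \<beta>))"
proof -
  have "(\<Sum>t\<in>{a<..<b}. 4 * (t + \<beta>) / (t + \<beta> - 1)\<^sup>2) \<le> 9 * \<rho> * (ln (b - 1 + \<beta>) - ln (a + \<beta>))"
    if "Suc a \<le> b" for b
    using that
  proof (induction b rule: dec_induct)
    case base
    have "{a<..<Suc a} = {}"
      by auto
    then show ?case
      by simp
  next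
    case (step b)
    have "{a<..<Suc b} = insert b {a<..<b}"
      using step.hyps by auto
    then have "(\<Sum>t\<in>{a<..<Suc b}. 4 * (t + \<beta>) / (t + \<beta> - 1)\<^sup>2)
        = 4 * (b + \<beta>) / (b + \<beta> - 1)\<^sup>2 + (\<Sum>t\<in>{a<..<b}. 4 * (t + \<beta>) / (t + \<beta> - 1)\<^sup>2)"
      by simp
    moreover have "4 * (b + \<beta>) / (b + \<beta> - 1)\<^sup>2 \<le> 9 * \<rho> * (ln (b + \<beta>) - ln (b + \<beta> - 1))"
      using drift_term_le_ln[of "b + \<beta> - 1" \<rho>] step.hyps assms by auto
    ultimately show ?case
      using step.IH by (simp add: algebra_simps)
  qed
  from this[of b] have "(\<Sum>t\<in>{a<..<b}. 4 * (t + \<beta>) / (t + \<beta> - 1)\<^sup>2)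
      \<le> 9 * \<rho> * (ln (b - 1 + \<beta>) - ln (a + \<beta>))"
    using assms(1) by simp
  also have "ln (b - 1 + \<beta>) - ln (a + \<beta>) = ln (1 + (real (b - a) - 1) / (a + \<beta>))"
  proof -
    have "1 + (real (b - a) - 1) / (a + \<beta>) = (b - 1 + \<beta>) / (a + \<beta>)"
      using assms by (simp add: of_nat_diff field_simps)
    then show ?thesis
      using assms by (simp add: ln_div)
  qed
  finally show ?thesis .
qed

text \<open>Write \<open>E\<close> for the logarithmic term of the condition \<open>cond\<close>. Replacing \<open>E\<close> by \<open>D\<close> saves at least
  \<open>p + q\<close>, where \<open>p = E / 4\<close> and \<open>q = 3 E / (4 n)\<close>. If the saving is at least \<open>1 / 2\<close>, the claim is
  immediate. Otherwise, since \<open>E\<close> is at least \<open>9 \<kappa>\<^sup>2 c / (s + 1)\<close>, the excess \<open>2 \<kappa> c / n\<close> of \<open>A\<close> over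
  \<open>2 \<kappa>\<close> is at most \<open>8 / 27 (s + 1) q\<close>, and \<open>2 \<kappa>\<close> itself is so far below \<open>s\<close> that the smallness of \<open>p\<close>
  and \<open>q\<close> is enough.\<close>

lemma step_size_condition_absorbs_half:
  fixes A c s \<kappa> l D :: real and n :: nat
  assumes "1 \<le> \<kappa>" and "2 * \<kappa>\<^sup>2 + 1 \<le> s" and "0 \<le> c" and "1 \<le> n"
    and A: "A = 2 * \<kappa> * (1 + c / real n)"
    and l: "1 / (s + 1) \<le> l"
    and cond: "9 * \<kappa>\<^sup>2 * c * l + A \<le> s + 1"
    and D: "D \<le> 3 / 4 * (1 - 1 / n) * (9 * \<kappa>\<^sup>2 * c * l)"
  shows "A + D \<le> s + 1 / 2"
proof -
  define E where "E = 9 * \<kappa>\<^sup>2 * c * l"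
  define p where "p = E / 4"
  define q where "q = 3 / 4 * E / n"
  have \<kappa>_sq: "2 * \<kappa> \<le> \<kappa>\<^sup>2 + 1" "\<kappa> \<le> \<kappa>\<^sup>2"
    using assms(1) sum_squares_bound[of \<kappa> 1] by (simp_all add: power2_eq_square)
  have s: "3 \<le> s"
    using assms(1,2) \<kappa>_sq by linarith
  have "0 \<le> 1 / (s + 1)"
    using s by simp
  then have "0 \<le> l"
    using l by linarith
  then have "0 \<le> E"
    using assms(1,3) by (simp add: E_def)
  then have pq: "0 \<le> p" "0 \<le> q"
    by (simp_all add: p_def q_def)
  have DE: "D \<le> E - p - q"
    using D unfolding E_def[symmetric] by (simp add: p_def q_def algebra_simps)
  show ?thesis
  proof (cases "1 / 2 \<le> p + q")
    case True
    then show ?thesis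
      using DE cond unfolding E_def[symmetric] by linarith
  next
    case False
    have "9 * \<kappa>\<^sup>2 * c * (1 / (s + 1)) \<le> E"
      unfolding E_def using l assms(1,3) by (intro mult_left_mono) auto
    then have "9 * \<kappa>\<^sup>2 * c \<le> (s + 1) * E"
      using s by (simp add: field_simps)
    moreover have "\<kappa> * c \<le> \<kappa>\<^sup>2 * c"
      using \<kappa>_sq assms(3) by (intro mult_right_mono) auto
    ultimately have "9 * (\<kappa> * c) \<le> (s + 1) * E"
      by linarith
    then have "9 * (\<kappa> * c) / n \<le> (s + 1) * E / n"
      by (intro divide_right_mono) auto
    then have cn: "27 / 4 * (\<kappa> * c / n) \<le> (s + 1) * q"
      unfolding q_def by argo
    have "A = 2 * \<kappa> + 2 * (\<kappa> * c / n)"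
      by (simp add: A algebra_simps)
    also have "\<dots> \<le> 2 * \<kappa> + 8 / 27 * ((s + 1) * q)"
      using cn by simp
    finally have AD: "A + D \<le> 2 * \<kappa> + 3 * p + (8 / 27 * (s + 1) - 1) * q"
      using DE by (simp add: p_def algebra_simps)
    \<comment> \<open>a function linear and increasing in \<open>p\<close> and \<open>q\<close> on the triangle \<open>p + q < 1 / 2\<close>, to be checked at its two far corners\<close>
    show ?thesis
    proof (cases "8 / 27 * (s + 1) - 1 \<le> 3")
      case True
      then have "(8 / 27 * (s + 1) - 1) * q \<le> 3 * q"
        using pq by (intro mult_right_mono)
      then show ?thesis
        using AD False \<kappa>_sq assms(2) by linarith
    next
      case big: False
      then have "3 * p \<le> (8 / 27 * (s + 1) - 1) * p"
        using pq by (intro mult_right_mono) auto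
      then have "A + D \<le> 2 * \<kappa> + (8 / 27 * (s + 1) - 1) * (p + q)"
        using AD unfolding distrib_left by linarith
      also have "\<dots> \<le> 2 * \<kappa> + (8 / 27 * (s + 1) - 1) * (1 / 2)"
        using big False by (intro add_left_mono mult_left_mono) auto
      finally show ?thesis
        using \<kappa>_sq assms(2) s by argo
    qed
  qed
qed

text \<open>Multiplied by \<open>s\<^sup>2\<close>, the recursion for the gap telescopes over the round. The dispersion at time \<open>t\<close> is
  charged to the sum \<open>S\<close> of all gradient moments of the round rather than to those before \<open>t\<close>: every step then
  carries the same charge \<open>D\<close>, no exchange of summations is needed, and the first step, which carries the
  largest charge anyway, loses nothing. The hypotheses \<open>later\<close> and \<open>first\<close> say that the charge is
  affordable; in the first step the gap itself takes part, with weight \<open>w\<close>.\<close>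

lemma communication_round:
  fixes \<xi> V G Q :: "nat \<Rightarrow> real" and a b n :: nat and \<beta> \<mu> L A N c \<sigma> w D :: real
  assumes ab: "a < b" and \<mu>: "0 < \<mu>" and c: "0 \<le> c" and n: "1 \<le> n" and \<beta>: "2 \<le> \<beta>"
    and \<xi>_nonneg: "\<And>t. 0 \<le> \<xi> t" and G_nonneg: "\<And>t. 0 \<le> G t"
    and PL: "\<And>t. t \<in> {a..<b} \<Longrightarrow> 2 * \<mu> * \<xi> t \<le> Q t"
    and descent: "\<And>t. t \<in> {a..<b} \<Longrightarrow> (t + \<beta>)\<^sup>2 * \<xi> (Suc t) \<le> (t + \<beta>)\<^sup>2 * \<xi> t - (t + \<beta>) / \<mu> * Q t
        - (t + \<beta> - A) / \<mu> * G t + (t + \<beta>) * L\<^sup>2 / \<mu> * V t + N"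
    and drift: "\<And>t. a \<le> t \<Longrightarrow> Suc t < b \<Longrightarrow> (t + \<beta>)\<^sup>2 * V (Suc t)
        \<le> (t + \<beta> - 1)\<^sup>2 * V t + 4 / \<mu>\<^sup>2 * (1 - 1 / n) * (c * G t + \<sigma>\<^sup>2)"
    and sync: "V a = 0" "G a = Q a"
    and D: "D = (L / \<mu>)\<^sup>2 * c * (1 - 1 / n) * (\<Sum>t\<in>{a<..<b}. 4 * (t + \<beta>) / (t + \<beta> - 1)\<^sup>2)"
    and later: "\<And>t. t \<in> {a<..<b} \<Longrightarrow> A + D \<le> t + \<beta>"
    and first: "A + D \<le> 2 * (a + \<beta>)" "(a + \<beta>)\<^sup>2 - 2 * (2 * (a + \<beta>) - A - D) \<le> w"
  shows "(b + \<beta> - 1)\<^sup>2 * \<xi> b \<le> w * \<xi> a + real (b - a) * N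
    + 9 * L\<^sup>2 * \<sigma>\<^sup>2 / \<mu> ^ 3 * (\<Sum>t = a..<b. (real t - real a) / (t + \<beta>))"
proof -
  \<comment> \<open>the dispersion vanishes at \<open>a\<close>, so \<open>a\<close> may carry no weight; the bound \<open>9 / (t + \<beta>)\<close> can fail there\<close>
  define h where "h t = (if t = a then 0 else 4 * (t + \<beta>) / (t + \<beta> - 1)\<^sup>2)" for t :: nat
  define S where "S = (\<Sum>t = a..<b. G t)"
  define B where "B t = 9 * L\<^sup>2 * \<sigma>\<^sup>2 / \<mu> ^ 3 * ((real t - real a) / (t + \<beta>))" for t :: nat
  have n_frac: "0 \<le> 1 - 1 / real n" "1 - 1 / real n \<le> 1"
    using n by auto
  have h_nonneg: "0 \<le> h t" for t
    using \<beta> by (simp add: h_def)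
  have h_le: "h t \<le> 9 / (t + \<beta>)" if "a \<le> t" for t
  proof (cases "t = a")
    case False
    then have "3 \<le> t + \<beta>"
      using that \<beta> by linarith
    then have "2 * (t + \<beta>) \<le> 3 * (t + \<beta> - 1)"
      by (simp add: algebra_simps)
    then have "(2 * (t + \<beta>))\<^sup>2 \<le> (3 * (t + \<beta> - 1))\<^sup>2"
      using \<beta> by (intro power_mono) auto
    then have "4 * (t + \<beta>)\<^sup>2 \<le> 9 * (t + \<beta> - 1)\<^sup>2"
      by (simp only: power_mult_distrib) simp
    then have "4 * (t + \<beta>)\<^sup>2 / ((t + \<beta>) * (t + \<beta> - 1)\<^sup>2) \<le> 9 * (t + \<beta> - 1)\<^sup>2 / ((t + \<beta>) * (t + \<beta> - 1)\<^sup>2)"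
      using \<open>3 \<le> t + \<beta>\<close> by (intro divide_right_mono) auto
    then show ?thesis
      using \<open>3 \<le> t + \<beta>\<close> False by (simp add: h_def power2_eq_square[of "t + \<beta>"])
  qed (use \<beta> in \<open>simp add: h_def\<close>)
  have V_le: "(t + \<beta> - 1)\<^sup>2 * V t \<le> 4 / \<mu>\<^sup>2 * (1 - 1 / n) * (\<Sum>k = a..<t. c * G k + \<sigma>\<^sup>2)"
    if "a \<le> t" "t < b" for t
    using that
  proof (induction t rule: dec_induct)
    case base
    then show ?case
      by (simp add: sync)
  next
    case (step t)
    have "4 / \<mu>\<^sup>2 * (1 - 1 / n) * (\<Sum>k = a..<Suc t. c * G k + \<sigma>\<^sup>2)
        = 4 / \<mu>\<^sup>2 * (1 - 1 / n) * (\<Sum>k = a..<t. c * G k + \<sigma>\<^sup>2) + 4 / \<mu>\<^sup>2 * (1 - 1 / n) * (c * G t + \<sigma>\<^sup>2)"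
      using step.hyps by (simp only: sum.atLeastLessThan_Suc distrib_left)
    moreover have "(Suc t + \<beta> - 1)\<^sup>2 * V (Suc t) = (t + \<beta>)\<^sup>2 * V (Suc t)"
      by simp
    ultimately show ?case
      using drift[of t] step by linarith
  qed
  have V_term: "(t + \<beta>) * L\<^sup>2 / \<mu> * V t \<le> (L / \<mu>)\<^sup>2 * c * (1 - 1 / n) * h t * S / \<mu> + B t"
    if t: "t \<in> {a..<b}" for t
  proof (cases "t = a")
    case True
    then show ?thesis
      by (simp add: sync h_def B_def)
  next
    case False
    then have s: "3 \<le> t + \<beta>"
      using t \<beta> by simp
    have "(\<Sum>k = a..<t. c * G k + \<sigma>\<^sup>2) = c * (\<Sum>k = a..<t. G k) + (real t - real a) * \<sigma>\<^sup>2"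
      using t by (simp add: sum.distrib sum_distrib_left of_nat_diff)
    also have "\<dots> \<le> c * S + (real t - real a) * \<sigma>\<^sup>2"
      unfolding S_def using t c G_nonneg by (intro add_right_mono mult_left_mono sum_mono2) auto
    finally have "4 / \<mu>\<^sup>2 * (1 - 1 / n) * (\<Sum>k = a..<t. c * G k + \<sigma>\<^sup>2)
        \<le> 4 / \<mu>\<^sup>2 * (1 - 1 / n) * (c * S + (real t - real a) * \<sigma>\<^sup>2)"
      using n_frac by (intro mult_left_mono) auto
    then have "(t + \<beta> - 1)\<^sup>2 * V t \<le> 4 / \<mu>\<^sup>2 * (1 - 1 / n) * (c * S + (real t - real a) * \<sigma>\<^sup>2)"
      using V_le[of t] t by simp
    then have "(t + \<beta>) * L\<^sup>2 / \<mu> / (t + \<beta> - 1)\<^sup>2 * ((t + \<beta> - 1)\<^sup>2 * V t)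
        \<le> (t + \<beta>) * L\<^sup>2 / \<mu> / (t + \<beta> - 1)\<^sup>2 * (4 / \<mu>\<^sup>2 * (1 - 1 / n) * (c * S + (real t - real a) * \<sigma>\<^sup>2))"
      using s \<mu> by (intro mult_left_mono) auto
    moreover have "(t + \<beta>) * L\<^sup>2 / \<mu> / (t + \<beta> - 1)\<^sup>2 * ((t + \<beta> - 1)\<^sup>2 * V t) = (t + \<beta>) * L\<^sup>2 / \<mu> * V t"
      using s by simp
    moreover have "(t + \<beta>) * L\<^sup>2 / \<mu> / (t + \<beta> - 1)\<^sup>2 * (4 / \<mu>\<^sup>2 * (1 - 1 / n) * (c * S + (real t - real a) * \<sigma>\<^sup>2))
        = L\<^sup>2 / \<mu> ^ 3 * (1 - 1 / n) * h t * (c * S + (real t - real a) * \<sigma>\<^sup>2)"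
    proof -
      have "u * L\<^sup>2 / \<mu> / v * (4 / \<mu>\<^sup>2 * y * z) = L\<^sup>2 / \<mu> ^ 3 * y * (4 * u / v) * z" for u v y z :: real
        by (simp add: power3_eq_cube power2_eq_square mult_ac)
      then show ?thesis
        using False by (simp only: h_def if_False)
    qed
    ultimately have "(t + \<beta>) * L\<^sup>2 / \<mu> * V t
        \<le> L\<^sup>2 / \<mu> ^ 3 * (1 - 1 / n) * h t * (c * S + (real t - real a) * \<sigma>\<^sup>2)"
      by (simp only:)
    also have "\<dots> = L\<^sup>2 / \<mu> ^ 3 * (1 - 1 / n) * h t * (c * S) + L\<^sup>2 / \<mu> ^ 3 * ((1 - 1 / n) * h t) * ((real t - real a) * \<sigma>\<^sup>2)"
      by (simp only: distrib_left mult.assoc)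
    also have "L\<^sup>2 / \<mu> ^ 3 * ((1 - 1 / n) * h t) * ((real t - real a) * \<sigma>\<^sup>2)
        \<le> L\<^sup>2 / \<mu> ^ 3 * (1 * (9 / (t + \<beta>))) * ((real t - real a) * \<sigma>\<^sup>2)"
      using t \<mu> n_frac h_nonneg h_le[of t] by (intro mult_right_mono mult_left_mono mult_mono) auto
    also have "L\<^sup>2 / \<mu> ^ 3 * (1 - 1 / n) * h t * (c * S) = (L / \<mu>)\<^sup>2 * c * (1 - 1 / n) * h t * S / \<mu>"
      using \<mu> by (simp add: power3_eq_cube power2_eq_square)
    finally show ?thesis
      by (simp add: B_def mult_ac)
  qed
  have step: "(Suc t + \<beta> - 1)\<^sup>2 * \<xi> (Suc t) - (t + \<beta> - 1)\<^sup>2 * \<xi> t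
      \<le> (if t = a then (2 * (a + \<beta>) - 1) * \<xi> a - (a + \<beta>) / \<mu> * G a else 0)
        + (A - (t + \<beta>)) / \<mu> * G t + (L / \<mu>)\<^sup>2 * c * (1 - 1 / n) * h t * S / \<mu> + B t + N"
    if t: "t \<in> {a..<b}" for t
  proof -
    have "(t + \<beta>)\<^sup>2 * \<xi> t - (t + \<beta>) / \<mu> * Q t
        \<le> (t + \<beta> - 1)\<^sup>2 * \<xi> t + (if t = a then (2 * (a + \<beta>) - 1) * \<xi> a - (a + \<beta>) / \<mu> * G a else 0)"
    proof (cases "t = a")
      case True
      then show ?thesis
        by (simp add: sync algebra_simps power2_eq_square)
    next
      case False
      have "(t + \<beta>) / \<mu> * (2 * \<mu> * \<xi> t) \<le> (t + \<beta>) / \<mu> * Q t"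
        using PL[OF t] \<mu> \<beta> by (intro mult_left_mono) auto
      then have "(t + \<beta>)\<^sup>2 * \<xi> t - (t + \<beta>) / \<mu> * Q t \<le> (t + \<beta>)\<^sup>2 * \<xi> t - 2 * ((t + \<beta>) * \<xi> t)"
        using \<mu> by (simp add: mult.assoc mult.left_commute[of _ 2])
      also have "\<dots> \<le> (t + \<beta> - 1)\<^sup>2 * \<xi> t"
        using \<xi>_nonneg[of t] by (simp add: algebra_simps power2_eq_square)
      finally show ?thesis
        using False by simp
    qed
    moreover have "(Suc t + \<beta> - 1)\<^sup>2 * \<xi> (Suc t) = (t + \<beta>)\<^sup>2 * \<xi> (Suc t)"
      by simp
    moreover have "(A - (t + \<beta>)) / \<mu> * G t = - ((t + \<beta> - A) / \<mu> * G t)"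
      by (simp add: algebra_simps diff_divide_distrib)
    ultimately show ?thesis
      using descent[OF t] V_term[OF t] by linarith
  qed
  have "(b + \<beta> - 1)\<^sup>2 * \<xi> b - (a + \<beta> - 1)\<^sup>2 * \<xi> a
      = (\<Sum>t = a..<b. (Suc t + \<beta> - 1)\<^sup>2 * \<xi> (Suc t) - (t + \<beta> - 1)\<^sup>2 * \<xi> t)"
    using ab sum_Suc_diff'[of a b "\<lambda>t. (t + \<beta> - 1)\<^sup>2 * \<xi> t"] by simp
  also have "\<dots> \<le> (\<Sum>t = a..<b. (if t = a then (2 * (a + \<beta>) - 1) * \<xi> a - (a + \<beta>) / \<mu> * G a else 0)
        + (A - (t + \<beta>)) / \<mu> * G t + (L / \<mu>)\<^sup>2 * c * (1 - 1 / n) * h t * S / \<mu> + B t + N)"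
    using step by (rule sum_mono)
  also have "\<dots> = (2 * (a + \<beta>) - 1) * \<xi> a - (a + \<beta>) / \<mu> * G a
      + ((\<Sum>t = a..<b. (A - (t + \<beta>)) / \<mu> * G t) + D * S / \<mu>) + (\<Sum>t = a..<b. B t) + real (b - a) * N"
  proof -
    have "(\<Sum>t = a..<b. h t) = (\<Sum>t\<in>{a<..<b}. 4 * (t + \<beta>) / (t + \<beta> - 1)\<^sup>2)"
      by (rule sum.mono_neutral_cong_right) (auto simp: h_def)
    then have "D * S / \<mu> = (\<Sum>t = a..<b. (L / \<mu>)\<^sup>2 * c * (1 - 1 / n) * h t * S / \<mu>)"
      by (simp add: D sum_distrib_left[symmetric] sum_distrib_right[symmetric] sum_divide_distrib[symmetric])
    then show ?thesis
      using ab by (simp add: sum.distrib)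
  qed
  finally have total: "(b + \<beta> - 1)\<^sup>2 * \<xi> b - (a + \<beta> - 1)\<^sup>2 * \<xi> a
      \<le> (2 * (a + \<beta>) - 1) * \<xi> a - (a + \<beta>) / \<mu> * G a
        + ((\<Sum>t = a..<b. (A - (t + \<beta>)) / \<mu> * G t) + D * S / \<mu>) + (\<Sum>t = a..<b. B t) + real (b - a) * N" .
  have "(\<Sum>t = a..<b. (A - (t + \<beta>)) / \<mu> * G t) + D * S / \<mu>
      = (\<Sum>t = a..<b. (A - (t + \<beta>)) / \<mu> * G t + D * G t / \<mu>)"
    by (simp add: S_def sum_distrib_left sum_divide_distrib sum.distrib)
  also have "\<dots> = (\<Sum>t = a..<b. (A + D - (t + \<beta>)) / \<mu> * G t)"
    by (intro sum.cong) (auto simp: diff_divide_distrib add_divide_distrib algebra_simps)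
  also have "\<dots> \<le> (\<Sum>t = a..<b. if t = a then (A + D - (a + \<beta>)) / \<mu> * G a else 0)"
    using later G_nonneg \<mu> by (intro sum_mono) (auto intro!: mult_nonpos_nonneg divide_nonpos_pos)
  also have "\<dots> = (A + D - (a + \<beta>)) / \<mu> * G a"
    using ab by simp
  finally have G_terms: "(\<Sum>t = a..<b. (A - (t + \<beta>)) / \<mu> * G t) + D * S / \<mu> \<le> (A + D - (a + \<beta>)) / \<mu> * G a" .
  have "(a + \<beta> - 1)\<^sup>2 * \<xi> a + (2 * (a + \<beta>) - 1) * \<xi> a = (a + \<beta>)\<^sup>2 * \<xi> a"
    by (simp add: algebra_simps power2_eq_square)
  moreover have "(A + D - (a + \<beta>)) / \<mu> * G a - (a + \<beta>) / \<mu> * G a = - ((2 * (a + \<beta>) - A - D) / \<mu> * G a)"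
    using \<mu> by (simp add: field_simps)
  ultimately have "(b + \<beta> - 1)\<^sup>2 * \<xi> b \<le> (a + \<beta>)\<^sup>2 * \<xi> a - (2 * (a + \<beta>) - A - D) / \<mu> * G a
      + (\<Sum>t = a..<b. B t) + real (b - a) * N"
    using total G_terms by linarith
  moreover have "(2 * (a + \<beta>) - A - D) / \<mu> * (2 * \<mu> * \<xi> a) \<le> (2 * (a + \<beta>) - A - D) / \<mu> * G a"
    using PL[of a] ab first(1) \<mu> sync by (intro mult_left_mono) auto
  then have "2 * (2 * (a + \<beta>) - A - D) * \<xi> a \<le> (2 * (a + \<beta>) - A - D) / \<mu> * G a"
    using \<mu> by (simp add: mult_ac)
  moreover have "((a + \<beta>)\<^sup>2 - 2 * (2 * (a + \<beta>) - A - D)) * \<xi> a \<le> w * \<xi> a"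
    using first(2) \<xi>_nonneg by (rule mult_right_mono)
  ultimately show ?thesis
    by (simp add: B_def sum_distrib_left left_diff_distrib)
qed

lemma comm_times_mono:
  fixes \<tau> :: "nat \<Rightarrow> nat"
  assumes "\<forall>i<R. \<tau> i < \<tau> (Suc i)" and "j \<le> k" and "k \<le> R"
  shows "\<tau> j \<le> \<tau> k"
  using assms(2,3)
proof (induction k rule: dec_induct)
  case (step k)
  then have "\<tau> k < \<tau> (Suc k)"
    using assms(1) by simp
  then show ?case
    using step by simp
qed simp

lemma last_comm_eq:
  assumes \<tau>_inc: "\<forall>i<R. \<tau> i < \<tau> (Suc i)" and "i < R" and "\<tau> i \<le> t" and "t < \<tau> (Suc i)"
  shows "last_comm \<tau> R t = \<tau> i"
  unfolding last_comm_def
proof (rule Max_eqI)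
  fix s
  assume "s \<in> {s \<in> \<tau> ` {0..R}. s \<le> t}"
  then obtain j where j: "s = \<tau> j" "j \<le> R" "\<tau> j \<le> t"
    by auto
  note mono = comm_times_mono[OF \<tau>_inc]
  have "j \<le> i"
    using mono[of "Suc i" j] j assms by fastforce
  then show "s \<le> \<tau> i"
    using mono[of j i] assms(2) j(1) by simp
qed (use assms in auto)

text \<open>Induction over the rounds. The gap carries the weight \<open>(\<tau> i + \<beta> - 1)\<^sup>2\<close> at the start of round \<open>i\<close>, except
  for the weight \<open>\<beta>\<^sup>2\<close> at time \<open>0\<close>.\<close>

lemma weighted_recursion:
  fixes \<xi> V G Q :: "nat \<Rightarrow> real" and n T R :: nat and \<tau> :: "nat \<Rightarrow> nat"
    and \<mu> L \<kappa> c \<sigma> \<beta> A N C :: real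
  assumes \<mu>: "0 < \<mu>" and \<mu>_le_L: "\<mu> \<le> L" and \<kappa>: "\<kappa> = L / \<mu>" and c: "0 \<le> c"
    and n: "1 \<le> n" and T: "1 \<le> T" and \<beta>: "2 * \<kappa>\<^sup>2 \<le> \<beta>"
    and \<tau>: "\<tau> 0 = 0" "\<forall>i<R. \<tau> i < \<tau> (Suc i)" "\<tau> R = T"
    and A: "A = 2 * \<kappa> * (1 + c / real n)" and C: "C = 9 * L\<^sup>2 * \<sigma>\<^sup>2 / \<mu> ^ 3"
    and cond: "\<forall>i<R. 9 * \<kappa>\<^sup>2 * c * ln (1 + (real (\<tau> (Suc i) - \<tau> i) - 1) / (real (\<tau> i) + \<beta>))
           + A - (real (\<tau> i) + 1 + \<beta>) \<le> 0"
    and \<xi>_nonneg: "\<And>t. 0 \<le> \<xi> t" and G_nonneg: "\<And>t. 0 \<le> G t"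
    and PL: "\<And>t. t < T \<Longrightarrow> 2 * \<mu> * \<xi> t \<le> Q t"
    and descent: "\<And>t. t < T \<Longrightarrow> (t + \<beta>)\<^sup>2 * \<xi> (Suc t) \<le> (t + \<beta>)\<^sup>2 * \<xi> t - (t + \<beta>) / \<mu> * Q t
        - (t + \<beta> - A) / \<mu> * G t + (t + \<beta>) * L\<^sup>2 / \<mu> * V t + N"
    and drift: "\<And>t. t < T \<Longrightarrow> Suc t \<notin> \<tau> ` {1..R} \<Longrightarrow> (t + \<beta>)\<^sup>2 * V (Suc t)
        \<le> (t + \<beta> - 1)\<^sup>2 * V t + 4 / \<mu>\<^sup>2 * (1 - 1 / n) * (c * G t + \<sigma>\<^sup>2)"
    and sync: "\<And>i. i < R \<Longrightarrow> V (\<tau> i) = 0" "\<And>i. i < R \<Longrightarrow> G (\<tau> i) = Q (\<tau> i)"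
  shows "(T + \<beta> - 1)\<^sup>2 * \<xi> T \<le> \<beta>\<^sup>2 * \<xi> 0 + T * N
    + C * (\<Sum>t = 0..<T. (real t - real (last_comm \<tau> R t)) / (t + \<beta>))"
proof -
  have \<kappa>_ge: "1 \<le> \<kappa>"
    using \<mu> \<mu>_le_L by (simp add: \<kappa>)
  have "1 \<le> \<kappa>\<^sup>2"
    using \<kappa>_ge by simp
  then have \<beta>_ge: "2 \<le> \<beta>"
    using \<beta> by linarith
  define E where "E i = 9 * \<kappa>\<^sup>2 * c * ln (1 + (real (\<tau> (Suc i) - \<tau> i) - 1) / (real (\<tau> i) + \<beta>))" for i
  have E_le: "E i + A \<le> real (\<tau> i) + 1 + \<beta>" if "i < R" for i
    using cond that by (simp add: E_def)
  have E_nonneg: "0 \<le> E i" if "i < R" for i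
  proof -
    have "1 \<le> real (\<tau> (Suc i) - \<tau> i)"
      using \<tau>(2) that by fastforce
    then show ?thesis
      unfolding E_def using c \<beta>_ge by (intro mult_nonneg_nonneg ln_ge_zero) auto
  qed
  note mono = comm_times_mono[OF \<tau>(2)]
  define W where "W i = (if i = 0 then \<beta>\<^sup>2 else (\<tau> i + \<beta> - 1)\<^sup>2)" for i
  let ?B = "\<lambda>t. (real t - real (last_comm \<tau> R t)) / (t + \<beta>)"
  have "W i * \<xi> (\<tau> i) \<le> \<beta>\<^sup>2 * \<xi> 0 + \<tau> i * N + C * (\<Sum>t = 0..<\<tau> i. ?B t)" if "i \<le> R" for i
    using that
  proof (induction i)
    case 0
    then show ?case
      by (simp add: W_def \<tau>(1))
  next
    case (Suc i)
    then have i: "i < R"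
      by simp
    let ?a = "\<tau> i" and ?b = "\<tau> (Suc i)"
    define D where "D = (L / \<mu>)\<^sup>2 * c * (1 - 1 / n) * (\<Sum>t\<in>{?a<..<?b}. 4 * (t + \<beta>) / (t + \<beta> - 1)\<^sup>2)"
    have ab: "?a < ?b"
      using \<tau>(2) i by blast
    have bT: "?b \<le> T"
      using mono[of "Suc i" R] Suc.prems \<tau>(3) by simp
    have n_frac: "0 \<le> 1 - 1 / real n" "1 - 1 / real n \<le> 1"
      using n by auto
    have D_le: "D \<le> \<rho> * (1 - 1 / n) * E i" if "\<rho> = 1 \<or> \<rho> = 3 / 4 \<and> 3 \<le> ?a + \<beta>" for \<rho>
    proof -
      have "D \<le> (L / \<mu>)\<^sup>2 * c * (1 - 1 / n) * (9 * \<rho> * ln (1 + (real (?b - ?a) - 1) / (?a + \<beta>)))"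
        unfolding D_def using sum_drift_le_ln[OF ab _ that] \<beta>_ge c n_frac
        by (intro mult_left_mono) auto
      then show ?thesis
        by (simp add: E_def \<kappa> mult_ac)
    qed
    have "(1 - 1 / n) * E i \<le> 1 * E i"
      using n_frac E_nonneg[OF i] by (intro mult_right_mono) auto
    then have "D \<le> E i"
      using D_le[of 1] by simp
    then have AD: "A + D \<le> ?a + 1 + \<beta>"
      using E_le[OF i] by linarith
    \<comment> \<open>in the first round the weight \<open>\<beta>\<^sup>2\<close> leaves ample room, later ones need the gain of \<open>1 / 2\<close>\<close>
    have first: "A + D \<le> 2 * (?a + \<beta>) \<and> (?a + \<beta>)\<^sup>2 - 2 * (2 * (?a + \<beta>) - A - D) \<le> W i"
    proof (cases "i = 0")
      case True
      then show ?thesis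
        using AD \<beta>_ge by (simp add: W_def \<tau>(1))
    next
      case False
      then have "\<tau> 1 \<le> ?a" "\<tau> 0 < \<tau> 1"
        using mono[of 1 i] i \<tau>(2) by auto
      then have a: "1 \<le> real ?a"
        by simp
      have "A + D \<le> ?a + \<beta> + 1 / 2"
      \<comment> \<open>a round of length one has no charge; then the condition for the first round bounds \<open>A\<close>\<close>
      proof (cases "?b = Suc ?a")
        case True
        then have "{?a<..<?b} = {}"
          by auto
        then have "D = 0"
          by (simp add: D_def)
        moreover have "A \<le> 1 + \<beta>"
          using E_le[of 0] E_nonneg[of 0] i \<tau>(1) by simp
        ultimately show ?thesis
          using a by simp
      next
        case False
        then have "2 \<le> real (?b - ?a)"
          using ab by linarith
        have "1 / (?a + \<beta> + 1) \<le> 2 / (2 * (?a + \<beta>) + 1)"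
          using \<beta>_ge by (simp add: field_simps)
        also have "\<dots> \<le> ln (?a + \<beta> + 1) - ln (?a + \<beta>)"
          using ln_inverse_approx_ge[of "?a + \<beta>" "?a + \<beta> + 1"] \<beta>_ge by (simp add: add_ac)
        also have "\<dots> = ln (1 + 1 / (?a + \<beta>))"
        proof -
          have "1 + 1 / (?a + \<beta>) = (?a + \<beta> + 1) / (?a + \<beta>)"
            using \<beta>_ge by (simp add: field_simps)
          then show ?thesis
            using \<beta>_ge by (simp add: ln_div)
        qed
        also have "\<dots> \<le> ln (1 + (real (?b - ?a) - 1) / (?a + \<beta>))"
          using \<open>2 \<le> real (?b - ?a)\<close> \<beta>_ge by (subst ln_le_cancel_iff) (auto intro!: divide_right_mono add_pos_nonneg)
        finally have ln_ge: "1 / (?a + \<beta> + 1) \<le> ln (1 + (real (?b - ?a) - 1) / (?a + \<beta>))" .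
        show ?thesis
        proof (rule step_size_condition_absorbs_half[OF \<kappa>_ge _ c n A ln_ge])
          show "2 * \<kappa>\<^sup>2 + 1 \<le> ?a + \<beta>"
            using \<beta> a by linarith
          show "D \<le> 3 / 4 * (1 - 1 / n) * (9 * \<kappa>\<^sup>2 * c * ln (1 + (real (?b - ?a) - 1) / (?a + \<beta>)))"
            using D_le[of "3 / 4"] a \<beta>_ge by (simp add: E_def)
        qed (use E_le[OF i] in \<open>simp add: E_def add_ac\<close>)
      qed
      then show ?thesis
        using False a \<beta>_ge by (simp add: W_def power2_diff)
    qed
    have "(?b + \<beta> - 1)\<^sup>2 * \<xi> ?b \<le> W i * \<xi> ?a + real (?b - ?a) * N
        + 9 * L\<^sup>2 * \<sigma>\<^sup>2 / \<mu> ^ 3 * (\<Sum>t = ?a..<?b. (real t - real ?a) / (t + \<beta>))"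
    proof (rule communication_round[where V = V and G = G and Q = Q and A = A and D = D and c = c and n = n])
      fix t
      assume t: "?a \<le> t" "Suc t < ?b"
      have "Suc t \<notin> \<tau> ` {1..R}"
      proof
        assume "Suc t \<in> \<tau> ` {1..R}"
        then obtain j where j: "Suc t = \<tau> j" "j \<le> R"
          by auto
        then show False
          using mono[of j i] mono[of "Suc i" j] t i by (cases "j \<le> i") auto
      qed
      then show "(t + \<beta>)\<^sup>2 * V (Suc t) \<le> (t + \<beta> - 1)\<^sup>2 * V t + 4 / \<mu>\<^sup>2 * (1 - 1 / n) * (c * G t + \<sigma>\<^sup>2)"
        using drift[of t] t bT by simp
    next
      fix t
      assume "t \<in> {?a<..<?b}"
      then have "?a + 1 \<le> t"
        by simp
      then have "real ?a + 1 \<le> real t"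
        by linarith
      then show "A + D \<le> t + \<beta>"
        using AD by linarith
    qed (use ab bT \<mu> c n \<beta>_ge \<xi>_nonneg G_nonneg PL descent sync i first in \<open>auto simp: D_def\<close>)
    moreover have "(\<Sum>t = ?a..<?b. (real t - real ?a) / (t + \<beta>)) = (\<Sum>t = ?a..<?b. ?B t)"
      using last_comm_eq[OF \<tau>(2) i] by (intro sum.cong) auto
    moreover have "(\<Sum>t = 0..<?b. ?B t) = (\<Sum>t = 0..<?a. ?B t) + (\<Sum>t = ?a..<?b. ?B t)"
      using ab by (simp add: sum.atLeastLessThan_concat)
    moreover have "real ?b * N = real ?a * N + real (?b - ?a) * N"
      using ab by (simp add: of_nat_diff algebra_simps)
    moreover have "W i * \<xi> ?a \<le> \<beta>\<^sup>2 * \<xi> 0 + ?a * N + C * (\<Sum>t = 0..<?a. ?B t)"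
      using Suc.IH i by simp
    ultimately show ?case
      by (simp add: W_def C distrib_left)
  qed
  from this[of R] show ?thesis
    using T \<tau> by (cases "R = 0") (auto simp: W_def)
qed

section \<open>Local SGD\<close>

lemma rescaled_descent:
  fixes s \<mu> \<xi> Q G V L c \<sigma> n r :: real
  assumes "0 < \<mu>" and "0 < s" and "0 < n" and r: "r = 2 / (\<mu> * s)"
  shows "s\<^sup>2 * (\<xi> - r / 2 * Q - r / 2 * G + r * L\<^sup>2 / 2 * V + L * r\<^sup>2 / 2 * ((1 + c / n) * G + \<sigma>\<^sup>2 / n))
    = s\<^sup>2 * \<xi> - s / \<mu> * Q - (s - 2 * (L / \<mu>) * (1 + c / n)) / \<mu> * G + s * L\<^sup>2 / \<mu> * V
      + 2 * L * \<sigma>\<^sup>2 / (n * \<mu>\<^sup>2)"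
proof -
  have sr: "s\<^sup>2 * r = 2 * s / \<mu>" "s\<^sup>2 * r\<^sup>2 = 4 / \<mu>\<^sup>2"
    using assms(1,2) by (simp_all add: r power2_eq_square)
  have "s\<^sup>2 * (\<xi> - r / 2 * Q - r / 2 * G + r * L\<^sup>2 / 2 * V + L * r\<^sup>2 / 2 * ((1 + c / n) * G + \<sigma>\<^sup>2 / n))
    = s\<^sup>2 * \<xi> - s\<^sup>2 * r / 2 * Q - s\<^sup>2 * r / 2 * G + s\<^sup>2 * r * L\<^sup>2 / 2 * V
      + s\<^sup>2 * r\<^sup>2 * L / 2 * ((1 + c / n) * G + \<sigma>\<^sup>2 / n)"
    by (simp add: algebra_simps)
  also have "\<dots> = s\<^sup>2 * \<xi> - s / \<mu> * Q - (s - 2 * (L / \<mu>) * (1 + c / n)) / \<mu> * G + s * L\<^sup>2 / \<mu> * V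
      + 2 * L * \<sigma>\<^sup>2 / (n * \<mu>\<^sup>2)"
    unfolding sr using assms(1,3) by (simp add: field_simps power2_eq_square)
  finally show ?thesis .
qed

lemma rescaled_drift:
  fixes s \<mu> V B m r :: real
  assumes "0 < \<mu>" and "0 < s" and r: "r = 2 / (\<mu> * s)"
  shows "s\<^sup>2 * ((1 - r * \<mu>) * V + r\<^sup>2 * m * B) = ((s - 1)\<^sup>2 - 1) * V + 4 / \<mu>\<^sup>2 * m * B"
proof -
  have sr: "s\<^sup>2 * r * \<mu> = 2 * s" "s\<^sup>2 * r\<^sup>2 = 4 / \<mu>\<^sup>2"
    using assms(1,2) by (simp_all add: r power2_eq_square)
  have "s\<^sup>2 * ((1 - r * \<mu>) * V + r\<^sup>2 * m * B) = (s\<^sup>2 - s\<^sup>2 * r * \<mu>) * V + s\<^sup>2 * r\<^sup>2 * m * B"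
    by (simp add: algebra_simps)
  also have "\<dots> = ((s - 1)\<^sup>2 - 1) * V + 4 / \<mu>\<^sup>2 * m * B"
    unfolding sr by (simp add: power2_diff)
  finally show ?thesis .
qed

lemma subalgebra_history:
  assumes "\<And>i k. i \<in> {1..n} \<Longrightarrow> k \<le> t \<Longrightarrow> x i k \<in> borel_measurable M"
    and "\<And>i k. i \<in> {1..n} \<Longrightarrow> k < t \<Longrightarrow> g i k \<in> borel_measurable M"
  shows "subalgebra M (history M n x g t)"
proof -
  let ?A = "{x i k -` B \<inter> space M | i k B. i \<in> {1..n} \<and> k \<le> t \<and> B \<in> sets borel} \<union>
      {g i k -` B \<inter> space M | i k B. i \<in> {1..n} \<and> k < t \<and> B \<in> sets borel}"
  have "?A \<subseteq> sets M"
    using assms by (auto intro: measurable_sets)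
  then have "sigma_sets (space M) ?A \<subseteq> sets M"
    by (rule sets.sigma_sets_subset)
  moreover have "?A \<subseteq> Pow (space M)"
    by auto
  then have "sets (history M n x g t) = sigma_sets (space M) ?A"
    unfolding history_def by (rule sets_measure_of)
  ultimately show ?thesis
    by (simp add: subalgebra_def history_def space_measure_of_conv)
qed

lemma iterate_measurable_history:
  assumes "i \<in> {1..n}" and "k \<le> t"
  shows "x i k \<in> borel_measurable (history M n x g t)"
proof (rule measurableI)
  fix B :: "'b set"
  assume "B \<in> sets borel"
  let ?A = "{x i k -` B \<inter> space M | i k B. i \<in> {1..n} \<and> k \<le> t \<and> B \<in> sets borel} \<union>
      {g i k -` B \<inter> space M | i k B. i \<in> {1..n} \<and> k < t \<and> B \<in> sets borel}"
  have "x i k -` B \<inter> space M \<in> ?A"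
    using assms \<open>B \<in> sets borel\<close> by blast
  moreover have "?A \<subseteq> Pow (space M)"
    by auto
  ultimately show "x i k -` B \<inter> space (history M n x g t) \<in> sets (history M n x g t)"
    unfolding history_def by (simp add: space_measure_of_conv sets_measure_of sigma_sets.Basic)
qed simp

theorem theorem1:
  fixes M :: "'w measure"
    and F :: "'a::euclidean_space \<Rightarrow> real" and gradF :: "'a \<Rightarrow> 'a" and x0 :: 'a
    and \<mu> L \<kappa> c \<sigma> \<beta> :: real
    and n T R :: nat and \<tau> :: "nat \<Rightarrow> nat" and \<eta> :: "nat \<Rightarrow> real"
    and x g :: "nat \<Rightarrow> nat \<Rightarrow> 'w \<Rightarrow> 'a"
  assumes "prob_space M"
    and "0 < \<mu>" and "\<mu> \<le> L" and "\<kappa> = L / \<mu>"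
    and "strongly_convex_smooth \<mu> L F gradF"
    and "0 \<le> c" and "0 \<le> \<sigma>" and "1 \<le> n" and "1 \<le> T"
    and "\<beta> \<ge> 2 * \<kappa>\<^sup>2"
    and "\<tau> 0 = 0" and "\<forall>i<R. \<tau> i < \<tau> (Suc i)" and "\<tau> R = T"
    and "\<forall>i<R. 9 * \<kappa>\<^sup>2 * c * ln (1 + (real (\<tau> (Suc i) - \<tau> i) - 1) / (real (\<tau> i) + \<beta>))
           + 2 * \<kappa> * (1 + c / real n) - (real (\<tau> i) + 1 + \<beta>) \<le> 0"
    and "\<forall>k<T. \<eta> k = 2 / (\<mu> * (real k + \<beta>))"
    and "\<forall>i\<in>{1..n}. \<forall>t<T. g i t \<in> borel_measurable M"
    and "\<forall>\<omega>\<in>space M. local_sgd n T (\<tau> ` {1..R}) \<eta> x0 (\<lambda>i t. x i t \<omega>) (\<lambda>i t. g i t \<omega>)"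
    and "noise_model M n T c \<sigma> gradF x g"
  shows "integrable M (\<lambda>\<omega>. F (worker_avg n (\<lambda>i. x i T \<omega>))) \<and>
    prob_space.expectation M (\<lambda>\<omega>. F (worker_avg n (\<lambda>i. x i T \<omega>))) - min_value F
      \<le> \<beta>\<^sup>2 * (F (worker_avg n (\<lambda>i. x0)) - min_value F) / (real T)\<^sup>2
        + 2 * L * \<sigma>\<^sup>2 / (real n * \<mu>\<^sup>2 * real T)
        + 9 * L\<^sup>2 * \<sigma>\<^sup>2 / (\<mu> ^ 3 * (real T)\<^sup>2)
            * (\<Sum>t = 0..<T. (real t - real (last_comm \<tau> R t)) / (real t + \<beta>))"
proof -
  note \<mu>_pos = assms(2) and \<mu>_le_L = assms(3) and \<kappa>_def = assms(4) and scs = assms(5)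
    and c_nonneg = assms(6) and n_pos = assms(8) and T_pos = assms(9) and \<beta>_ge = assms(10)
  interpret prob_space M
    by (rule assms(1))
  note scs_facts = scs \<mu>_pos \<mu>_le_L
  have gradF_meas: "gradF \<in> borel_measurable borel"
    using continuous_on_gradient[OF scs_facts] by (rule borel_measurable_continuous_onI)
  have gradF_sqi: "square_integrable M (\<lambda>\<omega>. gradF (X \<omega>))" if "square_integrable M X" for X
    using that by (rule square_integrable_Lipschitz[OF _ gradient_Lipschitz[OF scs_facts] gradF_meas])
  have x_0: "x i 0 \<omega> = x0" if "i \<in> {1..n}" "\<omega> \<in> space M" for i \<omega>
    using assms(17) that by (simp add: local_sgd_def)
  have x_Suc: "x i (Suc t) \<omega> = (if Suc t \<in> \<tau> ` {1..R} then worker_avg n (\<lambda>j. x j t \<omega> - \<eta> t *\<^sub>R g j t \<omega>)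
      else x i t \<omega> - \<eta> t *\<^sub>R g i t \<omega>)" if "t < T" "i \<in> {1..n}" "\<omega> \<in> space M" for t i \<omega>
    using assms(17) that by (simp add: local_sgd_def)
  define e where "e t i \<omega> = g i t \<omega> - gradF (x i t \<omega>)" for t i \<omega>
  let ?G = "\<lambda>t. history M n x g t"
  have noise: "cond_indep_vars M (?G t) (\<lambda>_. borel) (e t) {1..n}"
      "\<And>i. i \<in> {1..n} \<Longrightarrow> AE \<omega> in M. vec_cond_exp M (?G t) (e t i) \<omega> = 0"
      "\<And>i. i \<in> {1..n} \<Longrightarrow> AE \<omega> in M. nn_cond_exp M (?G t) (\<lambda>\<omega>'. ennreal ((norm (e t i \<omega>'))\<^sup>2)) \<omega>
          \<le> ennreal (c * (norm (gradF (x i t \<omega>)))\<^sup>2 + \<sigma>\<^sup>2)"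
    if "t < T" for t
    using assms(18) that unfolding noise_model_def Let_def e_def by auto
  have g_eq: "g i t \<omega> = gradF (x i t \<omega>) + e t i \<omega>" for i t \<omega>
    by (simp add: e_def)
  have e_props: "subalgebra M (?G t) \<and> (\<forall>i\<in>{1..n}. square_integrable M (e t i)
      \<and> expectation (\<lambda>\<omega>. (norm (e t i \<omega>))\<^sup>2) \<le> c * expectation (\<lambda>\<omega>. (norm (gradF (x i t \<omega>)))\<^sup>2) + \<sigma>\<^sup>2)"
    if t: "t < T" and x_sqi: "\<And>k i. k \<le> t \<Longrightarrow> i \<in> {1..n} \<Longrightarrow> square_integrable M (x i k)" for t
  proof (intro conjI ballI)
    show subalg: "subalgebra M (?G t)"
    proof (rule subalgebra_history)
      show "x i k \<in> borel_measurable M" if "i \<in> {1..n}" "k \<le> t" for i k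
        using x_sqi that by (intro square_integrableD(1))
      show "g i k \<in> borel_measurable M" if "i \<in> {1..n}" "k < t" for i k
        using assms(16) t that by simp
    qed
    fix i
    assume i: "i \<in> {1..n}"
    have grad_int: "integrable M (\<lambda>\<omega>. (norm (gradF (x i t \<omega>)))\<^sup>2)"
      using x_sqi[OF order_refl i] by (intro square_integrableD(2) gradF_sqi)
    have e_meas: "e t i \<in> borel_measurable M"
      unfolding e_def using assms(16) t i square_integrableD(1)[OF gradF_sqi[OF x_sqi[OF order_refl i]]]
      by (intro borel_measurable_diff) auto
    have h_int: "integrable M (\<lambda>\<omega>. c * (norm (gradF (x i t \<omega>)))\<^sup>2 + \<sigma>\<^sup>2)"
      using grad_int by simp
    have h_nonneg: "0 \<le> c * (norm (gradF (x i t \<omega>)))\<^sup>2 + \<sigma>\<^sup>2" for \<omega>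
      using c_nonneg by simp
    note moment = conditional_second_moment_bound[OF subalg e_meas noise(3)[OF t i] h_int h_nonneg]
    show "square_integrable M (e t i)"
      by (rule moment(1))
    show "expectation (\<lambda>\<omega>. (norm (e t i \<omega>))\<^sup>2) \<le> c * expectation (\<lambda>\<omega>. (norm (gradF (x i t \<omega>)))\<^sup>2) + \<sigma>\<^sup>2"
      using moment(2) grad_int by (simp add: prob_space)
  qed
  have x_sqi: "square_integrable M (x i k)" if "k \<le> T" "i \<in> {1..n}" for k i
  proof -
    \<comment> \<open>all earlier iterates are part of the induction hypothesis, for the history must be a subalgebra\<close>
    have "\<forall>k\<le>t. \<forall>i\<in>{1..n}. square_integrable M (x i k)" if "t \<le> T" for t
      using that
    proof (induction t)
      case 0
      have "square_integrable M (x i 0)" if "i \<in> {1..n}" for i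
        using square_integrable_cong[of M "x i 0" "\<lambda>_. x0"] x_0[OF that] square_integrable_const by simp
      then show ?case
        by simp
    next
      case (Suc t)
      then have t: "t < T" and IH: "\<And>k i. k \<le> t \<Longrightarrow> i \<in> {1..n} \<Longrightarrow> square_integrable M (x i k)"
        by auto
      have step: "square_integrable M (\<lambda>\<omega>. x i t \<omega> - \<eta> t *\<^sub>R g i t \<omega>)" if i: "i \<in> {1..n}" for i
        unfolding g_eq using e_props[OF t IH] i IH[OF order_refl i]
        by (intro square_integrable_diff square_integrable_scaleR square_integrable_add gradF_sqi) auto
      have "square_integrable M (x i (Suc t))" if i: "i \<in> {1..n}" for i
      proof (cases "Suc t \<in> \<tau> ` {1..R}")
        case True
        then have "square_integrable M (x i (Suc t))
            \<longleftrightarrow> square_integrable M (\<lambda>\<omega>. worker_avg n (\<lambda>j. x j t \<omega> - \<eta> t *\<^sub>R g j t \<omega>))"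
          using x_Suc[OF t i] by (intro square_integrable_cong) simp
        then show ?thesis
          using square_integrable_worker_avg[OF step] by simp
      next
        case False
        then have "square_integrable M (x i (Suc t)) \<longleftrightarrow> square_integrable M (\<lambda>\<omega>. x i t \<omega> - \<eta> t *\<^sub>R g i t \<omega>)"
          using x_Suc[OF t i] by (intro square_integrable_cong) simp
        then show ?thesis
          using step[OF i] by simp
      qed
      then show ?case
        using Suc by (auto simp: le_Suc_eq)
    qed
    then show ?thesis
      using that by blast
  qed
  have step_locale: "noisy_gradient_step M (?G t) \<mu> L c \<sigma> F gradF n (\<lambda>i. x i t) (e t)" if t: "t < T" for t
  proof unfold_locales
    have props: "subalgebra M (?G t)" "\<And>i. i \<in> {1..n} \<Longrightarrow> square_integrable M (e t i)"
      "\<And>i. i \<in> {1..n} \<Longrightarrow> expectation (\<lambda>\<omega>. (norm (e t i \<omega>))\<^sup>2) \<le> c * expectation (\<lambda>\<omega>. (norm (gradF (x i t \<omega>)))\<^sup>2) + \<sigma>\<^sup>2"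
      using e_props[OF t] x_sqi t by auto
    show "subalgebra M (?G t)" "\<And>i. i \<in> {1..n} \<Longrightarrow> square_integrable M (e t i)"
      "\<And>i. i \<in> {1..n} \<Longrightarrow> expectation (\<lambda>\<omega>. (norm (e t i \<omega>))\<^sup>2) \<le> c * expectation (\<lambda>\<omega>. (norm (gradF (x i t \<omega>)))\<^sup>2) + \<sigma>\<^sup>2"
      by (fact props)+
    show "\<And>i. i \<in> {1..n} \<Longrightarrow> square_integrable M (x i t)"
      using x_sqi t by simp
    show "\<And>i. i \<in> {1..n} \<Longrightarrow> x i t \<in> borel_measurable (?G t)"
      by (rule iterate_measurable_history) auto
  qed (use scs_facts n_pos noise[OF t] in auto)
  define xbar where "xbar t \<omega> = worker_avg n (\<lambda>i. x i t \<omega>)" for t \<omega>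
  \<comment> \<open>as the expectation of a nonnegative variable, the gap is nonnegative at all times, also beyond \<open>T\<close>\<close>
  define \<xi> where "\<xi> t = expectation (\<lambda>\<omega>. F (xbar t \<omega>) - min_value F)" for t
  define V where "V t = expectation (\<lambda>\<omega>. dispersion n (\<lambda>i. x i t \<omega>))" for t
  define Gr where "Gr t = worker_avg n (\<lambda>i. expectation (\<lambda>\<omega>. (norm (gradF (x i t \<omega>)))\<^sup>2))" for t
  define Q where "Q t = expectation (\<lambda>\<omega>. (norm (gradF (xbar t \<omega>)))\<^sup>2)" for t
  define A where "A = 2 * \<kappa> * (1 + c / real n)"
  define N where "N = 2 * L * \<sigma>\<^sup>2 / (real n * \<mu>\<^sup>2)"
  have xbar_sqi: "square_integrable M (xbar t)" if "t \<le> T" for t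
    unfolding xbar_def using that x_sqi by (intro square_integrable_worker_avg)
  have F_int: "integrable M (\<lambda>\<omega>. F (xbar t \<omega>))" if "t \<le> T" for t
    using xbar_sqi[OF that] by (rule integrable_objective[OF scs_facts])
  have \<xi>_eq: "\<xi> t = expectation (\<lambda>\<omega>. F (xbar t \<omega>)) - min_value F" if "t \<le> T" for t
    unfolding \<xi>_def using F_int[OF that] by (simp add: prob_space)
  have \<xi>_nonneg: "0 \<le> \<xi> t" for t
    unfolding \<xi>_def using min_value_le[OF scs_facts] by (intro Bochner_Integration.integral_nonneg) simp
  have \<kappa>_ge1: "1 \<le> \<kappa>"
    using \<mu>_pos \<mu>_le_L by (simp add: \<kappa>_def)
  have \<beta>_ge2: "2 \<le> \<beta>"
    using \<beta>_ge \<kappa>_ge1 one_le_power[OF \<kappa>_ge1, of 2] by linarith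
  have \<eta>_pos: "0 \<le> \<eta> t" and \<eta>_eq: "\<eta> t = 2 / (\<mu> * (t + \<beta>))" and \<eta>_small: "\<eta> t * L\<^sup>2 \<le> \<mu>" if "t < T" for t
  proof -
    show eq: "\<eta> t = 2 / (\<mu> * (t + \<beta>))"
      using assms(15) that by simp
    show "0 \<le> \<eta> t"
      unfolding eq using \<mu>_pos \<beta>_ge2 by simp
    have "2 * L\<^sup>2 = \<mu>\<^sup>2 * (2 * \<kappa>\<^sup>2)"
      using \<mu>_pos by (simp add: \<kappa>_def power_divide)
    also have "\<dots> \<le> \<mu>\<^sup>2 * (t + \<beta>)"
      using \<beta>_ge by (intro mult_left_mono) auto
    finally show "\<eta> t * L\<^sup>2 \<le> \<mu>"
      unfolding eq using \<mu>_pos \<beta>_ge2 by (simp add: divide_le_eq power2_eq_square mult_ac)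
  qed
  have xbar_Suc: "xbar (Suc t) \<omega> = worker_avg n (\<lambda>i. x i t \<omega> - \<eta> t *\<^sub>R (gradF (x i t \<omega>) + e t i \<omega>))"
    if "t < T" "\<omega> \<in> space M" for t \<omega>
  proof (cases "Suc t \<in> \<tau> ` {1..R}")
    case True
    then have "xbar (Suc t) \<omega> = worker_avg n (\<lambda>_. worker_avg n (\<lambda>i. x i t \<omega> - \<eta> t *\<^sub>R g i t \<omega>))"
      unfolding xbar_def using x_Suc that by (intro worker_avg_cong) simp
    then show ?thesis
      using n_pos by (simp add: worker_avg_const g_eq)
  next
    case False
    then have "xbar (Suc t) \<omega> = worker_avg n (\<lambda>i. x i t \<omega> - \<eta> t *\<^sub>R g i t \<omega>)"
      unfolding xbar_def using x_Suc that by (intro worker_avg_cong) simp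
    then show ?thesis
      by (simp add: g_eq)
  qed
  \<comment> \<open>agreement of the workers on the sample space suffices, as only expectations matter\<close>
  have synchronised: "V t = 0 \<and> Gr t = Q t"
    if same: "\<And>i \<omega>. i \<in> {1..n} \<Longrightarrow> \<omega> \<in> space M \<Longrightarrow> x i t \<omega> = z \<omega>" for t z
  proof
    have "V t = expectation (\<lambda>_. 0)"
      unfolding V_def using same n_pos by (intro Bochner_Integration.integral_cong dispersion_const) auto
    then show "V t = 0"
      by simp
    have "xbar t \<omega> = z \<omega>" if "\<omega> \<in> space M" for \<omega>
      using same that worker_avg_const[OF n_pos, of "z \<omega>"] worker_avg_cong[of n "\<lambda>i. x i t \<omega>" "\<lambda>_. z \<omega>"]
      by (simp add: xbar_def)
    then have "expectation (\<lambda>\<omega>. (norm (gradF (x i t \<omega>)))\<^sup>2) = Q t" if "i \<in> {1..n}" for i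
      unfolding Q_def using same[OF that] by (intro Bochner_Integration.integral_cong) auto
    then have "Gr t = worker_avg n (\<lambda>_. Q t)"
      unfolding Gr_def by (rule worker_avg_cong)
    then show "Gr t = Q t"
      using n_pos by (simp add: worker_avg_const)
  qed
  have \<tau>_le: "\<tau> i \<le> T" "0 < i \<Longrightarrow> 0 < \<tau> i" if "i \<le> R" for i
  proof -
    note mono = comm_times_mono[OF assms(12)]
    show "\<tau> i \<le> T"
      using mono[of i R] that assms(13) by simp
    show "0 < \<tau> i" if "0 < i"
    proof -
      have "\<tau> 0 < \<tau> 1"
        using that \<open>i \<le> R\<close> assms(12) by auto
      also have "\<dots> \<le> \<tau> i"
        using mono[of 1 i] that \<open>i \<le> R\<close> by simp
      finally show ?thesis
        by simp
    qed
  qed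
  have sync: "V (\<tau> i) = 0 \<and> Gr (\<tau> i) = Q (\<tau> i)" if i: "i < R" for i
  proof (cases "i = 0")
    case True
    then show ?thesis
      using synchronised[of 0 "\<lambda>_. x0"] x_0 assms(11) by simp
  next
    case False
    then obtain t where t: "\<tau> i = Suc t" "t < T"
      using \<tau>_le[OF less_imp_le[OF i]] False by (cases "\<tau> i") auto
    have "Suc t \<in> \<tau> ` {1..R}"
      using False i t(1) by (auto simp: image_iff intro!: bexI[of _ i])
    then show ?thesis
      using synchronised[of "Suc t" "\<lambda>\<omega>. worker_avg n (\<lambda>j. x j t \<omega> - \<eta> t *\<^sub>R g j t \<omega>)"] x_Suc[OF t(2)] t(1)
      by simp
  qed
  have "(T + \<beta> - 1)\<^sup>2 * \<xi> T \<le> \<beta>\<^sup>2 * \<xi> 0 + T * N + 9 * L\<^sup>2 * \<sigma>\<^sup>2 / \<mu> ^ 3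
      * (\<Sum>t = 0..<T. (real t - real (last_comm \<tau> R t)) / (t + \<beta>))"
  proof (rule weighted_recursion[OF \<mu>_pos \<mu>_le_L \<kappa>_def c_nonneg n_pos T_pos \<beta>_ge assms(11,12,13) A_def refl _ \<xi>_nonneg,
        where V = V and G = Gr and Q = Q])
    show "\<forall>i<R. 9 * \<kappa>\<^sup>2 * c * ln (1 + (real (\<tau> (Suc i) - \<tau> i) - 1) / (real (\<tau> i) + \<beta>)) + A
        - (real (\<tau> i) + 1 + \<beta>) \<le> 0"
      using assms(14) by (simp add: A_def)
    show "0 \<le> Gr t" for t
      unfolding Gr_def by (intro worker_avg_nonneg Bochner_Integration.integral_nonneg) simp
    show "V (\<tau> i) = 0" "Gr (\<tau> i) = Q (\<tau> i)" if "i < R" for i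
      using sync[OF that] by auto
  next
    fix t
    assume t: "t < T"
    have "expectation (\<lambda>\<omega>. 2 * \<mu> * (F (xbar t \<omega>) - min_value F)) \<le> Q t"
      unfolding Q_def using Polyak_Lojasiewicz[OF scs_facts] F_int[of t] xbar_sqi[of t] t
      by (intro integral_mono square_integrableD(2) gradF_sqi) auto
    then show "2 * \<mu> * \<xi> t \<le> Q t"
      by (simp add: \<xi>_def)
  next
    fix t
    assume t: "t < T"
    interpret step: noisy_gradient_step M "?G t" \<mu> L c \<sigma> F gradF n "\<lambda>i. x i t" "e t"
      using t by (rule step_locale)
    let ?s = "t + \<beta>"
    have s_pos: "0 < ?s"
      using \<beta>_ge2 by simp
    have "expectation (\<lambda>\<omega>. F (xbar (Suc t) \<omega>))
        = expectation (\<lambda>\<omega>. F (worker_avg n (\<lambda>i. x i t \<omega> - \<eta> t *\<^sub>R (gradF (x i t \<omega>) + e t i \<omega>))))"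
      using xbar_Suc[OF t] by (intro Bochner_Integration.integral_cong) auto
    then have "\<xi> (Suc t) \<le> \<xi> t - \<eta> t / 2 * Q t - \<eta> t / 2 * Gr t + \<eta> t * L\<^sup>2 / 2 * V t
        + L * (\<eta> t)\<^sup>2 / 2 * ((1 + c / n) * Gr t + \<sigma>\<^sup>2 / n)"
      using step.expected_descent[OF \<eta>_pos[OF t]] t
      by (simp add: \<xi>_eq V_def Gr_def Q_def xbar_def)
    then have "?s\<^sup>2 * \<xi> (Suc t) \<le> ?s\<^sup>2 * (\<xi> t - \<eta> t / 2 * Q t - \<eta> t / 2 * Gr t + \<eta> t * L\<^sup>2 / 2 * V t
        + L * (\<eta> t)\<^sup>2 / 2 * ((1 + c / n) * Gr t + \<sigma>\<^sup>2 / n))"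
      by (rule mult_left_mono) simp
    also have "\<dots> = ?s\<^sup>2 * \<xi> t - ?s / \<mu> * Q t - (?s - A) / \<mu> * Gr t + ?s * L\<^sup>2 / \<mu> * V t + N"
      unfolding A_def N_def \<kappa>_def using n_pos by (intro rescaled_descent \<mu>_pos s_pos \<eta>_eq[OF t]) simp
    finally show "?s\<^sup>2 * \<xi> (Suc t) \<le> ?s\<^sup>2 * \<xi> t - ?s / \<mu> * Q t - (?s - A) / \<mu> * Gr t + ?s * L\<^sup>2 / \<mu> * V t + N" .
  next
    fix t
    assume t: "t < T" and no_comm: "Suc t \<notin> \<tau> ` {1..R}"
    interpret step: noisy_gradient_step M "?G t" \<mu> L c \<sigma> F gradF n "\<lambda>i. x i t" "e t"
      using t by (rule step_locale)
    let ?s = "t + \<beta>"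
    have s_pos: "0 < ?s"
      using \<beta>_ge2 by simp
    have "V (Suc t) = expectation (\<lambda>\<omega>. dispersion n (\<lambda>i. x i t \<omega> - \<eta> t *\<^sub>R (gradF (x i t \<omega>) + e t i \<omega>)))"
      unfolding V_def dispersion_def
    proof (intro Bochner_Integration.integral_cong refl)
      fix \<omega>
      assume \<omega>: "\<omega> \<in> space M"
      have "worker_avg n (\<lambda>i. x i (Suc t) \<omega>) = worker_avg n (\<lambda>i. x i t \<omega> - \<eta> t *\<^sub>R (gradF (x i t \<omega>) + e t i \<omega>))"
        using xbar_Suc[OF t \<omega>] by (simp add: xbar_def)
      then show "worker_avg n (\<lambda>i. (norm (x i (Suc t) \<omega> - worker_avg n (\<lambda>i. x i (Suc t) \<omega>)))\<^sup>2)
          = worker_avg n (\<lambda>i. (norm (x i t \<omega> - \<eta> t *\<^sub>R (gradF (x i t \<omega>) + e t i \<omega>)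
              - worker_avg n (\<lambda>i. x i t \<omega> - \<eta> t *\<^sub>R (gradF (x i t \<omega>) + e t i \<omega>))))\<^sup>2)"
        using x_Suc[OF t _ \<omega>] no_comm by (intro worker_avg_cong) (simp add: g_eq)
    qed
    then have "V (Suc t) \<le> (1 - \<eta> t * \<mu>) * V t + (\<eta> t)\<^sup>2 * (1 - 1 / n) * (c * Gr t + \<sigma>\<^sup>2)"
      using step.expected_dispersion_after_step[OF \<eta>_pos[OF t] \<eta>_small[OF t]] by (simp add: V_def Gr_def)
    then have "?s\<^sup>2 * V (Suc t) \<le> ?s\<^sup>2 * ((1 - \<eta> t * \<mu>) * V t + (\<eta> t)\<^sup>2 * (1 - 1 / n) * (c * Gr t + \<sigma>\<^sup>2))"
      by (rule mult_left_mono) simp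
    also have "\<dots> = ((?s - 1)\<^sup>2 - 1) * V t + 4 / \<mu>\<^sup>2 * (1 - 1 / n) * (c * Gr t + \<sigma>\<^sup>2)"
      using \<mu>_pos s_pos \<eta>_eq[OF t] by (rule rescaled_drift)
    finally have "?s\<^sup>2 * V (Suc t) \<le> ((?s - 1)\<^sup>2 - 1) * V t + 4 / \<mu>\<^sup>2 * (1 - 1 / n) * (c * Gr t + \<sigma>\<^sup>2)" .
    moreover have "0 \<le> V t"
      unfolding V_def dispersion_def by (intro Bochner_Integration.integral_nonneg worker_avg_nonneg) simp
    ultimately show "?s\<^sup>2 * V (Suc t) \<le> (?s - 1)\<^sup>2 * V t + 4 / \<mu>\<^sup>2 * (1 - 1 / n) * (c * Gr t + \<sigma>\<^sup>2)"
      by (simp add: left_diff_distrib)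
  qed
  moreover have "(real T)\<^sup>2 \<le> (T + \<beta> - 1)\<^sup>2"
    using \<beta>_ge2 by (intro power_mono) auto
  then have "(real T)\<^sup>2 * \<xi> T \<le> (T + \<beta> - 1)\<^sup>2 * \<xi> T"
    using \<xi>_nonneg by (intro mult_right_mono)
  ultimately have "(real T)\<^sup>2 * \<xi> T \<le> \<beta>\<^sup>2 * \<xi> 0 + T * N + 9 * L\<^sup>2 * \<sigma>\<^sup>2 / \<mu> ^ 3
      * (\<Sum>t = 0..<T. (real t - real (last_comm \<tau> R t)) / (t + \<beta>))"
    by linarith
  then have "\<xi> T \<le> (\<beta>\<^sup>2 * \<xi> 0 + T * N + 9 * L\<^sup>2 * \<sigma>\<^sup>2 / \<mu> ^ 3
      * (\<Sum>t = 0..<T. (real t - real (last_comm \<tau> R t)) / (t + \<beta>))) / (real T)\<^sup>2"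
    using T_pos by (simp add: pos_le_divide_eq mult.commute)
  also have "\<dots> = \<beta>\<^sup>2 * \<xi> 0 / (real T)\<^sup>2 + 2 * L * \<sigma>\<^sup>2 / (real n * \<mu>\<^sup>2 * real T)
        + 9 * L\<^sup>2 * \<sigma>\<^sup>2 / (\<mu> ^ 3 * (real T)\<^sup>2)
            * (\<Sum>t = 0..<T. (real t - real (last_comm \<tau> R t)) / (real t + \<beta>))"
  proof -
    have "T * N / (real T)\<^sup>2 = 2 * L * \<sigma>\<^sup>2 / (real n * \<mu>\<^sup>2 * real T)"
      using T_pos by (simp add: N_def power2_eq_square)
    then show ?thesis
      by (simp add: add_divide_distrib)
  qed
  also have "\<xi> 0 = F (worker_avg n (\<lambda>i. x0)) - min_value F"
  proof -
    have "xbar 0 \<omega> = worker_avg n (\<lambda>i. x0)" if "\<omega> \<in> space M" for \<omega>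
      unfolding xbar_def using x_0 that by (intro worker_avg_cong) simp
    then have "\<xi> 0 = expectation (\<lambda>_. F (worker_avg n (\<lambda>i. x0)) - min_value F)"
      unfolding \<xi>_def by (intro Bochner_Integration.integral_cong) auto
    then show ?thesis
      by (simp add: prob_space)
  qed
  finally show ?thesis
    using F_int[of T] \<xi>_eq[of T] by (simp add: xbar_def)
qed

end
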